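(* Let $\gamma\ge1$ and $f\in\mathrm{RES}(-\gamma)$. Then, for every fixed $d\in\mathbb{N}=\{1,2,\dots\}$, $$\lim_{t\to\infty}\hat P_t(d,f)=0\quad\text{almost surely.}$$
   Context: Model. An edge-step function is a function $f:[1,\infty)\to[0,1]$. Let $(Z_t)_{t\ge 2}$ be independent with $Z_t\sim\mathrm{Ber}(f(t))$. The random multigraph process $(G_t(f))_{t\ge1}$ starts with $G_1$ = one vertex with one loop. Given $G_t(f)$, if $Z_{t+1}=1$ perform a vertex-step: add a new vertex $v$ and an edge $\{u,v\}$, where the existing vertex $u$ is chosen with probability proportional to its degree in $G_t(f)$. If $Z_{t+1}=0$ perform an edge-step: add an edge $\{u_1,u_2\}$, where $u_1,u_2$ are chosen independently among existing vertices, each with probability proportional to its degree in $G_t(f)$ (loops and parallel edges allowed). A loop contributes $2$ to the degree, so the total degree of $G_t(f)$ is $2t$. $\hat P_t(d,f)$ is the (random) proportion of vertices of $G_t(f)$ having degree exactly $d$. A positive function $g$ is regularly varying (at infinity) with index $\rho\in\mathbb{R}$ if $\lim_{t\to\infty}g(at)/g(t)=a^\rho$ for all $a>0$. $\mathrm{RES}(-\gamma)$ is the set of continuous (positive) functions $f:[1,\infty)\to[0,1]$ that decrease (monotonically) to $0$ at infinity and are regularly varying with index $-\gamma$. *)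

theory Defs
  imports "HOL-Probability.Probability"
begin

section \<open>Regularly varying edge-step functions\<close>

definition regularly_varying :: "(real \<Rightarrow> real) \<Rightarrow> real \<Rightarrow> bool" where
  "regularly_varying g \<rho> \<longleftrightarrow>
     (\<forall>a>0. ((\<lambda>t. g (a * t) / g t) \<longlongrightarrow> a powr \<rho>) at_top)"

text \<open>Functions on \<open>[1, \<infinity>)\<close> are total functions on the reals of which only the
  restriction to \<open>{1..}\<close> matters; decreasing is meant in the weak sense.\<close>

definition edge_step_function :: "(real \<Rightarrow> real) \<Rightarrow> bool" where
  "edge_step_function f \<longleftrightarrow> (\<forall>t\<ge>1. 0 \<le> f t \<and> f t \<le> 1)"

definition RES :: "real \<Rightarrow> (real \<Rightarrow> real) set" where
  "RES \<rho> = {f. edge_step_function f \<and> (\<forall>t\<ge>1. 0 < f t) \<and> continuous_on {1..} f \<and>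
     antimono_on {1..} f \<and> (f \<longlongrightarrow> 0) at_top \<and> regularly_varying f \<rho>}"


section \<open>Finite multigraphs with loops\<close>

text \<open>A multigraph is given by its number \<open>n\<close> of vertices, which are \<open>0, \<dots>, n - 1\<close> in
  order of arrival, and its multiset of edges. An edge is a two-element multiset of
  vertices, so that the loop at \<open>v\<close> is \<open>{#v, v#}\<close> and contributes 2 to the degree of \<open>v\<close>.\<close>

type_synonym multigraph = "nat \<times> nat multiset multiset"

definition verts :: "multigraph \<Rightarrow> nat set" where
  "verts H = {..<fst H}"

definition edges :: "multigraph \<Rightarrow> nat multiset multiset" where
  "edges H = snd H"

definition vertex_degree :: "multigraph \<Rightarrow> nat \<Rightarrow> nat" where
  "vertex_degree H v = (\<Sum>e\<in>#edges H. count e v)"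

definition degree_proportion :: "multigraph \<Rightarrow> nat \<Rightarrow> real" where
  "degree_proportion H d = real (card {v \<in> verts H. vertex_degree H v = d}) / real (card (verts H))"

definition single_loop :: multigraph where
  "single_loop = (1, {#{#0, 0#}#})"


section \<open>The edge-step process\<close>

definition attach_pmf :: "multigraph \<Rightarrow> nat pmf" where
  "attach_pmf H = embed_pmf (\<lambda>v. if v \<in> verts H
     then real (vertex_degree H v) / real (\<Sum>u\<in>verts H. vertex_degree H u) else 0)"

text \<open>The argument of \<^const>\<open>embed_pmf\<close> above is a probability mass function as soon as the
  total degree is not zero.\<close>

lemma pmf_attach_pmf:
  assumes "(\<Sum>u\<in>verts H. vertex_degree H u) \<noteq> 0"
  shows "pmf (attach_pmf H) v = (if v \<in> verts H
     then real (vertex_degree H v) / real (\<Sum>u\<in>verts H. vertex_degree H u) else 0)"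
proof -
  let ?D = "real (\<Sum>u\<in>verts H. vertex_degree H u)"
  let ?p = "\<lambda>v. if v \<in> verts H then real (vertex_degree H v) / ?D else 0"
  have fin: "finite (verts H)" by (simp add: verts_def)
  have "(\<integral>\<^sup>+v. ennreal (?p v) \<partial>count_space UNIV) = (\<Sum>v\<in>verts H. ennreal (?p v))"
    using fin by (intro nn_integral_count_space') auto
  also have "\<dots> = ennreal (\<Sum>v\<in>verts H. ?p v)"
    by (intro sum_ennreal) (auto intro!: divide_nonneg_nonneg sum_nonneg)
  also have "(\<Sum>v\<in>verts H. ?p v) = (\<Sum>v\<in>verts H. real (vertex_degree H v)) / ?D"
    by (subst sum_divide_distrib) (rule sum.cong, auto)
  also have "\<dots> = 1"
    using assms by (metis div_self of_nat_eq_0_iff of_nat_sum)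
  finally have "(\<integral>\<^sup>+v. ennreal (?p v) \<partial>count_space UNIV) = 1" by simp
  then show ?thesis
    unfolding attach_pmf_def by (subst pmf_embed_pmf) (auto intro!: divide_nonneg_nonneg sum_nonneg)
qed

definition vertex_step :: "multigraph \<Rightarrow> multigraph pmf" where
  "vertex_step H = do {
     u \<leftarrow> attach_pmf H;
     return_pmf (fst H + 1, add_mset {#u, fst H#} (edges H)) }"

definition edge_step :: "multigraph \<Rightarrow> multigraph pmf" where
  "edge_step H = do {
     u1 \<leftarrow> attach_pmf H;
     u2 \<leftarrow> attach_pmf H;
     return_pmf (fst H, add_mset {#u1, u2#} (edges H)) }"

definition step_pmf :: "bool \<Rightarrow> multigraph \<Rightarrow> multigraph pmf" where
  "step_pmf z H = (if z then vertex_step H else edge_step H)"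

text \<open>\<open>Z t\<close> is the indicator, as a truth value, of a vertex-step at time \<open>t\<close>. The assumption
  \<open>transition\<close> says that, conditionally on the history
  \<open>G 1, Z 2, G 2, \<dots>, Z t, G t\<close>, the variable \<open>Z (t + 1)\<close> is Bernoulli with parameter
  \<open>f (t + 1)\<close>, i.e.\ it is independent of the history, and that, conditionally on the history
  and on \<open>Z (t + 1)\<close>, the graph \<open>G (t + 1)\<close> results from the corresponding random step
  applied to \<open>G t\<close>. Independence of the \<open>Z t\<close> from each other would not suffice here: the
  choices made up to time \<open>t\<close> could then still influence \<open>Z (t + 1)\<close>. The graph \<open>G 0\<close> plays
  no role.\<close>

locale edge_step_process = prob_space M
  for M :: "'a measure" +
  fixes f :: "real \<Rightarrow> real"
    and Z :: "nat \<Rightarrow> 'a \<Rightarrow> bool"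
    and G :: "nat \<Rightarrow> 'a \<Rightarrow> multigraph"
  assumes edge_step_function: "edge_step_function f"
    and Z_indep: "indep_vars (\<lambda>_. count_space UNIV) Z {2..}"
    and Z_distr: "\<And>t. t \<ge> 2 \<Longrightarrow>
          distr M (count_space UNIV) (Z t) = measure_pmf (bernoulli_pmf (f (real t)))"
    and G_measurable: "\<And>t. t \<ge> 1 \<Longrightarrow> G t \<in> measurable M (count_space UNIV)"
    and G_start: "AE \<omega> in M. G 1 \<omega> = single_loop"
    and transition: "\<And>t g z b h. t \<ge> 1 \<Longrightarrow>
          prob {\<omega> \<in> space M. (\<forall>s\<in>{1..t}. G s \<omega> = g s) \<and> (\<forall>s\<in>{2..t}. Z s \<omega> = z s) \<and>
                  Z (t + 1) \<omega> = b \<and> G (t + 1) \<omega> = h} =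
          prob {\<omega> \<in> space M. (\<forall>s\<in>{1..t}. G s \<omega> = g s) \<and> (\<forall>s\<in>{2..t}. Z s \<omega> = z s)} *
          pmf (bernoulli_pmf (f (real (t + 1)))) b * pmf (step_pmf b (g t)) h"

end

theory Submission
  imports Defs "HOL-Real_Asymp.Real_Asymp"
begin

text \<open>Let \<open>\<Phi>\<^sub>t\<close> be the sum of \<open>(d + 1 - deg v)\<^sup>+\<close> over the vertices of \<open>G\<^sub>t\<close>; it dominates the
  number of vertices of degree \<open>d\<close>. A vertex-step increases it by at most \<open>d\<close>, and at every step
  the first random endpoint has degree at most \<open>d\<close>, and so decreases it, with a probability
  between \<open>\<Phi>\<^sub>t / (2dt)\<close> and \<open>d\<Phi>\<^sub>t / (2t)\<close>. Let \<open>F t\<close> be the expected number of vertices.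

  If \<open>F\<close> is bounded, the number of vertices is eventually constant, so that \<open>\<Phi>\<close> is eventually
  nonincreasing, and the drift gives \<open>E (\<Sum>t. \<Phi>\<^sub>t / t) < \<infinity>\<close>; hence the integers \<open>\<Phi>\<^sub>t\<close> reach 0.

  If \<open>F\<close> is unbounded, \<open>\<gamma> \<ge> 1\<close> gives \<open>t f(t) / F(t) \<longlonglongrightarrow> 0\<close>, so \<open>\<Phi>\<close> has negative drift
  wherever \<open>\<Phi>\<^sub>t \<ge> \<eta> F(t)\<close>, and the second moment of \<open>(\<Phi>\<^sub>t - \<eta> F(t))\<^sup>+\<close> is \<open>O(F t)\<close>; the
  variance of the number of vertices is at most \<open>F t\<close> as well. Along times at which \<open>F\<close> is about
  \<open>k\<^sup>2\<close> the Chebyshev bounds are summable, and between two such times \<open>\<Phi>\<close> grows by at most \<open>d\<close>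
  times the number of new vertices, which is negligible.\<close>

section \<open>Low degrees in one step\<close>

text \<open>The outcome of a step once its random choices are fixed, so that the effect on degrees
  becomes pure combinatorics.\<close>

definition grow :: "bool \<Rightarrow> nat \<Rightarrow> nat \<Rightarrow> multigraph \<Rightarrow> multigraph" where
  "grow b u1 u2 H = (if b then (fst H + 1, add_mset {#u1, fst H#} (edges H))
     else (fst H, add_mset {#u1, u2#} (edges H)))"

text \<open>Invariant of the process at time \<open>t\<close>, when the graph has exactly
  \<open>t\<close> edges. Positivity of all degrees is what the lower bound
  \<open>attach_low_degree_ge\<close> rests on.\<close>

definition valid_graph :: "nat \<Rightarrow> multigraph \<Rightarrow> bool" where
  "valid_graph t H \<longleftrightarrow> 1 \<le> fst H \<and> fst H \<le> t \<and> size (edges H) = t \<and>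
     (\<forall>e\<in>#edges H. size e = 2 \<and> set_mset e \<subseteq> verts H) \<and>
     (\<forall>v\<in>verts H. 1 \<le> vertex_degree H v)"

text \<open>Subtraction of natural numbers acts as the positive part: a vertex of degree above
  \<open>d\<close> contributes 0, any other vertex at least 1.\<close>

definition deficit :: "nat \<Rightarrow> multigraph \<Rightarrow> nat" where
  "deficit d H = (\<Sum>v\<in>verts H. d + 1 - vertex_degree H v)"

lemma finite_verts [simp]: "finite (verts H)"
  by (simp add: verts_def)

lemma edges_grow:
  "edges (grow b u1 u2 H) = add_mset (if b then {#u1, fst H#} else {#u1, u2#}) (edges H)"
  by (simp add: grow_def edges_def)

lemma verts_grow: "verts (grow b u1 u2 H) = (if b then insert (fst H) (verts H) else verts H)"
  by (auto simp: grow_def verts_def)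

lemma fst_grow: "fst (grow b u1 u2 H) = fst H + of_bool b"
  by (simp add: grow_def)

lemma vertex_degree_grow:
  "vertex_degree (grow b u1 u2 H) v =
     count (if b then {#u1, fst H#} else {#u1, u2#}) v + vertex_degree H v"
  by (simp add: vertex_degree_def edges_grow)

lemma sum_mset_count:
  assumes "finite A" "set_mset e \<subseteq> A"
  shows "(\<Sum>v\<in>A. count e v) = size e"
proof -
  have "(\<Sum>v\<in>A. count e v) = (\<Sum>v\<in>set_mset e. count e v)"
    using assms by (intro sum.mono_neutral_right) (auto simp: not_in_iff)
  then show ?thesis
    by (simp add: size_multiset_overloaded_eq)
qed

lemma total_degree:
  assumes "valid_graph t H"
  shows "(\<Sum>v\<in>verts H. vertex_degree H v) = 2 * t"
proof -
  \<comment> \<open>Handshake argument: the multiset of edges varies in the induction while the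
    vertex set stays that of \<open>H\<close>.\<close>
  have "(\<Sum>v\<in>verts H. \<Sum>e\<in>#E. count e v) = 2 * size E"
    if "\<forall>e\<in>#E. size e = 2 \<and> set_mset e \<subseteq> verts H" for E
    using that by (induction E) (auto simp: sum.distrib sum_mset_count)
  then show ?thesis
    using assms by (simp add: valid_graph_def vertex_degree_def)
qed

lemma vertex_degree_new:
  assumes "valid_graph t H"
  shows "vertex_degree H (fst H) = 0"
proof -
  have "count e (fst H) = 0" if "e \<in># edges H" for e
    using assms that by (fastforce simp: valid_graph_def verts_def not_in_iff[symmetric])
  then show ?thesis
    by (auto simp: vertex_degree_def)
qed

lemma valid_graph_single_loop: "valid_graph 1 single_loop"
  by (auto simp: valid_graph_def single_loop_def edges_def verts_def vertex_degree_def)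

lemma valid_graph_grow:
  assumes "valid_graph t H" "u1 \<in> verts H" "u2 \<in> verts H"
  shows "valid_graph (Suc t) (grow b u1 u2 H)"
  using assms unfolding valid_graph_def edges_grow verts_grow fst_grow vertex_degree_grow
  by (cases b) (auto simp: verts_def le_SucI trans_le_add2)

text \<open>The endpoint \<open>u1\<close> gains a degree and thus lowers its own term by at least
  one if its degree was at most \<open>d\<close>; a second endpoint can only lower the sum further.
  A new vertex arrives with degree 1 and adds exactly \<open>d\<close>. The additive form avoids
  truncated subtraction.\<close>

lemma deficit_grow:
  assumes "valid_graph t H" "u1 \<in> verts H"
  shows "deficit d (grow b u1 u2 H) + of_bool (vertex_degree H u1 \<le> d) \<le> deficit d H + d * of_bool b"
proof -
  have new: "fst H \<notin> verts H" by (simp add: verts_def)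
  then have ne: "u1 \<noteq> fst H" using assms(2) by auto
  have *: "(\<Sum>v\<in>verts H. d + 1 - vertex_degree (grow b u1 u2 H) v) +
      of_bool (vertex_degree H u1 \<le> d) \<le> deficit d H"
  proof -
    have "(\<Sum>v\<in>verts H. d + 1 - vertex_degree (grow b u1 u2 H) v) +
        of_bool (vertex_degree H u1 \<le> d) =
      (\<Sum>v\<in>verts H. (d + 1 - vertex_degree (grow b u1 u2 H) v) +
        of_bool (v = u1 \<and> vertex_degree H u1 \<le> d))"
    proof -
      \<comment> \<open>The indicator is spread over the vertices as a point mass at
        \<open>u1\<close>, so that the inequality can be checked term by term.\<close>
      have "(\<Sum>v\<in>verts H. of_bool (v = u1 \<and> vertex_degree H u1 \<le> d)) =
          (\<Sum>v\<in>verts H. if v = u1 then of_bool (vertex_degree H u1 \<le> d) else (0 :: nat))"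
        by (intro sum.cong) auto
      then show ?thesis
        using assms(2) by (simp add: sum.distrib)
    qed
    also have "\<dots> \<le> deficit d H"
      unfolding deficit_def by (rule sum_mono) (auto simp: vertex_degree_grow)
    finally show ?thesis .
  qed
  show ?thesis
  proof (cases b)
    case True
    then have "vertex_degree (grow b u1 u2 H) (fst H) = 1"
      using ne vertex_degree_new[OF assms(1)] by (simp add: vertex_degree_grow)
    then show ?thesis
      using * True new by (simp add: deficit_def verts_grow)
  next
    case False
    then show ?thesis
      using * by (simp add: deficit_def verts_grow)
  qed
qed

lemma card_low_degree_le_deficit:
  "card {v \<in> verts H. vertex_degree H v \<le> d} \<le> deficit d H"
proof -
  have "card {v \<in> verts H. vertex_degree H v \<le> d} = (\<Sum>v\<in>verts H. of_bool (vertex_degree H v \<le> d))"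
    by (simp add: Int_def)
  also have "\<dots> \<le> deficit d H"
    unfolding deficit_def by (rule sum_mono) auto
  finally show ?thesis .
qed

lemma degree_proportion_le:
  "degree_proportion H d \<le> real (deficit d H) / real (fst H)"
proof -
  have "card {v \<in> verts H. vertex_degree H v = d} \<le> card {v \<in> verts H. vertex_degree H v \<le> d}"
    by (rule card_mono) auto
  also have "\<dots> \<le> deficit d H"
    by (rule card_low_degree_le_deficit)
  finally show ?thesis
    by (simp add: degree_proportion_def verts_def divide_right_mono)
qed

section \<open>Probability that a random endpoint has low degree\<close>

lemma pmf_attach:
  assumes "valid_graph t H" "t \<ge> 1"
  shows "pmf (attach_pmf H) v = (if v \<in> verts H then real (vertex_degree H v) / real (2 * t) else 0)"
  using pmf_attach_pmf[of H v] total_degree[OF assms(1)] assms(2) by simp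

lemma set_attach_pmf:
  assumes "valid_graph t H" "t \<ge> 1"
  shows "set_pmf (attach_pmf H) \<subseteq> verts H"
  using pmf_attach[OF assms] by (auto simp: set_pmf_eq split: if_splits)

lemma expectation_attach_low_degree:
  assumes "valid_graph t H" "t \<ge> 1"
  shows "measure_pmf.expectation (attach_pmf H) (\<lambda>u. of_bool (vertex_degree H u \<le> d)) =
    (\<Sum>v | v \<in> verts H \<and> vertex_degree H v \<le> d. real (vertex_degree H v)) / real (2 * t)"
proof -
  have "measure_pmf.expectation (attach_pmf H) (\<lambda>u. of_bool (vertex_degree H u \<le> d) :: real) =
      (\<Sum>v\<in>verts H. of_bool (vertex_degree H v \<le> d) * pmf (attach_pmf H) v)"
    using set_attach_pmf[OF assms] by (intro integral_measure_pmf_real) auto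
  also have "\<dots> = (\<Sum>v | v \<in> verts H \<and> vertex_degree H v \<le> d. real (vertex_degree H v) / real (2 * t))"
    by (intro sum.mono_neutral_cong_right) (auto simp: pmf_attach[OF assms])
  finally show ?thesis
    by (simp add: sum_divide_distrib)
qed

text \<open>A vertex of degree k with 1 \<le> k \<le> d satisfies d + 1 - k \<le> d \<le> d k, so
  its term in the deficit is at most \<open>d\<close> times its attachment weight. This is the
  source of the negative drift.\<close>

lemma attach_low_degree_ge:
  assumes "valid_graph t H" "t \<ge> 1" "d \<ge> 1"
  shows "real (deficit d H) / (2 * real d * real t) \<le>
    measure_pmf.expectation (attach_pmf H) (\<lambda>u. of_bool (vertex_degree H u \<le> d))"
proof -
  have "d + 1 - vertex_degree H v \<le> d * (if vertex_degree H v \<le> d then vertex_degree H v else 0)"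
    if "v \<in> verts H" for v
  proof -
    have "1 \<le> vertex_degree H v"
      using that assms(1) by (simp add: valid_graph_def)
    moreover from this have "d \<le> d * vertex_degree H v"
      by simp
    ultimately show ?thesis
      by (auto intro: order_trans[of _ d])
  qed
  then have "deficit d H \<le> (\<Sum>v\<in>verts H. d * (if vertex_degree H v \<le> d then vertex_degree H v else 0))"
    unfolding deficit_def by (rule sum_mono)
  also have "\<dots> = d * (\<Sum>v | v \<in> verts H \<and> vertex_degree H v \<le> d. vertex_degree H v)"
    by (simp add: sum_distrib_left[symmetric] sum.inter_filter)
  finally have "real (deficit d H) \<le> real (d * (\<Sum>v | v \<in> verts H \<and> vertex_degree H v \<le> d. vertex_degree H v))"
    by (simp only: of_nat_le_iff)
  then show ?thesis
    using assms(2,3) unfolding expectation_attach_low_degree[OF assms(1,2)]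
    by (simp add: field_simps)
qed

text \<open>A vertex of low degree has weight at most \<open>d\<close> and contributes at least 1 to
  the deficit. The bound controls the noise in the second moment.\<close>

lemma attach_low_degree_le:
  assumes "valid_graph t H" "t \<ge> 1"
  shows "measure_pmf.expectation (attach_pmf H) (\<lambda>u. of_bool (vertex_degree H u \<le> d)) \<le>
    real d * real (deficit d H) / (2 * real t)"
proof -
  have "(\<Sum>v | v \<in> verts H \<and> vertex_degree H v \<le> d. vertex_degree H v) \<le>
      d * card {v \<in> verts H. vertex_degree H v \<le> d}"
    using sum_bounded_above[of "{v \<in> verts H. vertex_degree H v \<le> d}" "vertex_degree H" d]
    by (simp add: mult.commute)
  also have "\<dots> \<le> d * deficit d H"
    by (intro mult_left_mono card_low_degree_le_deficit) simp
  finally have "real (\<Sum>v | v \<in> verts H \<and> vertex_degree H v \<le> d. vertex_degree H v) \<le> real (d * deficit d H)"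
    by (simp only: of_nat_le_iff)
  then show ?thesis
    using assms(2) unfolding expectation_attach_low_degree[OF assms]
    by (simp add: divide_simps)
qed

section \<open>The laws of the graphs as a Markov chain\<close>

definition step_kernel :: "real \<Rightarrow> multigraph \<Rightarrow> multigraph pmf" where
  "step_kernel q H = bind_pmf (bernoulli_pmf q) (\<lambda>b. step_pmf b H)"

text \<open>The recursion starts at time 1, whence \<open>t - 1\<close>; its stage \<open>s\<close>
  leads from time \<open>s + 1\<close> to time \<open>s + 2\<close> and therefore uses
  \<open>f\<close> at \<open>s + 2\<close>.\<close>

definition graph_pmf :: "(real \<Rightarrow> real) \<Rightarrow> nat \<Rightarrow> multigraph pmf" where
  "graph_pmf f t =
     rec_nat (return_pmf single_loop) (\<lambda>s p. bind_pmf p (step_kernel (f (real (s + 2))))) (t - 1)"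

lemma graph_pmf_1: "graph_pmf f (Suc 0) = return_pmf single_loop"
  by (simp add: graph_pmf_def)

lemma graph_pmf_Suc:
  "t \<ge> 1 \<Longrightarrow> graph_pmf f (Suc t) = bind_pmf (graph_pmf f t) (step_kernel (f (real (Suc t))))"
  by (cases t) (simp_all add: graph_pmf_def add.commute)

text \<open>A vertex-step also draws the second endpoint \<open>u2\<close>, which it ignores: both kinds of
  step then become functions of the same three independent random choices.\<close>

lemma step_kernel_eq_map:
  "step_kernel q H =
     map_pmf (\<lambda>x. grow (fst x) (fst (snd x)) (snd (snd x)) H)
       (pair_pmf (bernoulli_pmf q) (pair_pmf (attach_pmf H) (attach_pmf H)))"
proof -
  have "step_pmf b H = bind_pmf (attach_pmf H) (\<lambda>u1. bind_pmf (attach_pmf H)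
      (\<lambda>u2. return_pmf (grow b u1 u2 H)))" for b
    by (simp add: step_pmf_def vertex_step_def edge_step_def grow_def)
  then show ?thesis
    by (simp add: step_kernel_def pair_pmf_def map_pmf_def bind_assoc_pmf bind_return_pmf)
qed

lemma set_step_kernel:
  assumes "valid_graph t H" "t \<ge> 1"
  shows "set_pmf (step_kernel q H) \<subseteq> (\<lambda>x. grow (fst x) (fst (snd x)) (snd (snd x)) H) ` (UNIV \<times> verts H \<times> verts H)"
  using set_attach_pmf[OF assms] by (auto simp: step_kernel_eq_map)

text \<open>Only finitely many choices exist at each step. Finite support makes every real function
  of the graph integrable.\<close>

lemma set_graph_pmf:
  assumes "t \<ge> 1"
  shows "finite (set_pmf (graph_pmf f t)) \<and> (\<forall>H\<in>set_pmf (graph_pmf f t). valid_graph t H)"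
  using assms
proof (induction t rule: dec_induct)
  case base
  then show ?case
    using valid_graph_single_loop by (simp add: graph_pmf_1)
next
  case (step t)
  have "finite (set_pmf (step_kernel q H))" if "H \<in> set_pmf (graph_pmf f t)" for H q
    using that step by (intro finite_subset[OF set_step_kernel[of t]]) auto
  moreover have "valid_graph (Suc t) H'"
    if "H \<in> set_pmf (graph_pmf f t)" "H' \<in> set_pmf (step_kernel q H)" for H H' q
    using that step set_step_kernel[of t H q] by (auto intro!: valid_graph_grow)
  ultimately show ?case
    using step by (auto simp: graph_pmf_Suc)
qed

lemmas finite_set_graph_pmf = set_graph_pmf[THEN conjunct1]

lemma valid_graph_pmf: "t \<ge> 1 \<Longrightarrow> H \<in> set_pmf (graph_pmf f t) \<Longrightarrow> valid_graph t H"
  using set_graph_pmf by blast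

text \<open>An affine bound in the indicators of a vertex-step and of a first endpoint of low degree is
  enough also for squared increments: the cross term of the two indicators has a negative
  coefficient and can be dropped.\<close>

lemma step_kernel_expectation_le:
  fixes u :: "multigraph \<Rightarrow> real"
  assumes "valid_graph t H" "t \<ge> 1" "0 \<le> q" "q \<le> 1"
    and le: "\<And>b u1 u2. u1 \<in> verts H \<Longrightarrow> u2 \<in> verts H \<Longrightarrow>
      u (grow b u1 u2 H) \<le> \<alpha> + \<beta> * of_bool b + \<delta> * of_bool (vertex_degree H u1 \<le> d)"
  shows "measure_pmf.expectation (step_kernel q H) u \<le>
    \<alpha> + \<beta> * q + \<delta> * measure_pmf.expectation (attach_pmf H) (\<lambda>u. of_bool (vertex_degree H u \<le> d))"
proof -
  let ?A = "attach_pmf H"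
  let ?P = "pair_pmf (bernoulli_pmf q) (pair_pmf ?A ?A)"
  have fin: "finite (set_pmf ?A)"
    using finite_subset[OF set_attach_pmf[OF assms(1,2)]] by simp
  have finP: "finite (set_pmf ?P)"
    by (simp add: fin)
  note int = integrable_measure_pmf_finite[OF finP]
  have "measure_pmf.expectation (step_kernel q H) u \<le>
    measure_pmf.expectation ?P (\<lambda>x. \<alpha> + \<beta> * of_bool (fst x) + \<delta> * of_bool (vertex_degree H (fst (snd x)) \<le> d))"
    unfolding step_kernel_eq_map integral_map_pmf
    using le set_attach_pmf[OF assms(1,2)]
    by (intro integral_mono_AE int) (auto simp: AE_measure_pmf_iff subset_iff simp del: of_bool_eq_1_iff)
  also have "\<dots> = \<alpha> + \<beta> * measure_pmf.expectation ?P (\<lambda>x. of_bool (fst x)) +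
      \<delta> * measure_pmf.expectation ?P (\<lambda>x. of_bool (vertex_degree H (fst (snd x)) \<le> d))"
    by (simp add: int)
  also have "measure_pmf.expectation ?P (\<lambda>x. of_bool (fst x) :: real) = q"
    using assms(3,4) by (subst expectation_pair_pmf_fst) simp
  also have "measure_pmf.expectation ?P (\<lambda>x. of_bool (vertex_degree H (fst (snd x)) \<le> d)) =
      measure_pmf.expectation ?A (\<lambda>u. of_bool (vertex_degree H u \<le> d) :: real)"
    using expectation_pair_pmf_snd[of "bernoulli_pmf q" "pair_pmf ?A ?A"
        "\<lambda>y. of_bool (vertex_degree H (fst y) \<le> d) :: real"]
      expectation_pair_pmf_fst[of ?A ?A "\<lambda>u. of_bool (vertex_degree H u \<le> d) :: real"]
    by (simp only:)
  finally show ?thesis .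
qed

text \<open>Tower property as an inequality: a bound on the conditional expectation at every valid
  graph suffices.\<close>

lemma expectation_graph_pmf_Suc_le:
  fixes u v :: "multigraph \<Rightarrow> real"
  assumes "t \<ge> 1"
    and le: "\<And>H. valid_graph t H \<Longrightarrow> measure_pmf.expectation (step_kernel (f (real (Suc t))) H) u \<le> v H"
  shows "measure_pmf.expectation (graph_pmf f (Suc t)) u \<le> measure_pmf.expectation (graph_pmf f t) v"
proof -
  let ?p = "graph_pmf f t" and ?K = "step_kernel (f (real (Suc t)))"
  have fin: "finite (set_pmf ?p)" by (rule finite_set_graph_pmf[OF assms(1)])
  have "measure_pmf.expectation (graph_pmf f (Suc t)) u =
      (\<Sum>H\<in>set_pmf ?p. pmf ?p H *\<^sub>R measure_pmf.expectation (?K H) u)"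
    unfolding graph_pmf_Suc[OF assms(1)]
    using fin finite_subset[OF set_step_kernel[OF valid_graph_pmf[OF assms(1)] assms(1)]]
    by (intro pmf_expectation_bind) auto
  also have "\<dots> \<le> (\<Sum>H\<in>set_pmf ?p. v H * pmf ?p H)"
  proof (rule sum_mono)
    fix H assume "H \<in> set_pmf ?p"
    then have "measure_pmf.expectation (?K H) u \<le> v H"
      by (intro le valid_graph_pmf[OF assms(1)])
    then show "pmf ?p H *\<^sub>R measure_pmf.expectation (?K H) u \<le> v H * pmf ?p H"
      by (simp add: mult.commute[of "v H"] mult_left_mono)
  qed
  also have "\<dots> = measure_pmf.expectation ?p v"
    by (rule integral_measure_pmf_real[symmetric]) (auto simp: fin)
  finally show ?thesis .
qed

section \<open>The law of the process\<close>

text \<open>Law of total probability over the values of \<open>H\<close>; it serves to sum over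
  histories and over graphs.\<close>

lemma emeasure_countable_partition:
  assumes "countable C" "\<And>\<omega>. \<omega> \<in> space M \<Longrightarrow> H \<omega> \<in> C"
    and "\<And>x. x \<in> C \<Longrightarrow> {\<omega> \<in> space M. H \<omega> = x \<and> Q \<omega>} \<in> sets M"
  shows "emeasure M {\<omega> \<in> space M. Q \<omega>} =
    (\<integral>\<^sup>+x. emeasure M {\<omega> \<in> space M. H \<omega> = x \<and> Q \<omega>} \<partial>count_space C)"
proof -
  have "{\<omega> \<in> space M. Q \<omega>} = (\<Union>x\<in>C. {\<omega> \<in> space M. H \<omega> = x \<and> Q \<omega>})"
    using assms(2) by auto
  then show ?thesis
    using assms(1,3) by (auto intro!: emeasure_UN_countable simp: disjoint_family_on_def)
qed

lemma countable_multigraphs: "countable (UNIV :: multigraph set)"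
proof -
  have 1: "countable (UNIV :: nat multiset set)"
    by (metis countableI_type countable_image surj_mset)
  have "countable (lists (UNIV :: nat multiset set))"
    by (intro countable_lists 1)
  then have "countable (UNIV :: nat multiset multiset set)"
    by (metis lists_UNIV countable_image surj_mset)
  then have "countable ((UNIV :: nat set) \<times> (UNIV :: nat multiset multiset set))"
    by (intro countable_SIGMA) auto
  then show ?thesis by simp
qed

context edge_step_process
begin

lemma Z_measurable: "t \<ge> 2 \<Longrightarrow> Z t \<in> measurable M (count_space UNIV)"
  using Z_indep by (simp add: indep_vars_def2)

lemma f_bounds: "t \<ge> 1 \<Longrightarrow> 0 \<le> f t" "t \<ge> 1 \<Longrightarrow> f t \<le> 1"
  using edge_step_function by (auto simp: edge_step_function_def)

lemma sets_G_eq: "t \<ge> 1 \<Longrightarrow> {\<omega> \<in> space M. G t \<omega> = g} \<in> sets M"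
  using measurable_sets[OF G_measurable, of t "{g}"]
  by (simp add: vimage_def Int_def conj_commute)

lemma sets_Z_eq: "t \<ge> 2 \<Longrightarrow> {\<omega> \<in> space M. Z t \<omega> = b} \<in> sets M"
  using measurable_sets[OF Z_measurable, of t "{b}"]
  by (simp add: vimage_def Int_def conj_commute)

text \<open>The factor in \<open>transition\<close> depends on the history only through its last
  graph, so summing over all histories that end in \<open>g\<close> leaves it unchanged.\<close>

lemma Markov_step_Z:
  assumes "t \<ge> 1"
  shows "emeasure M {\<omega> \<in> space M. G t \<omega> = g \<and> Z (t + 1) \<omega> = b \<and> G (t + 1) \<omega> = h} =
    emeasure M {\<omega> \<in> space M. G t \<omega> = g} *
      ennreal (pmf (bernoulli_pmf (f (real (t + 1)))) b * pmf (step_pmf b g) h)"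
proof -
  \<comment> \<open>Histories are restricted to finite index sets and so are extensional functions;
    this makes their range \<open>C\<close> countable.\<close>
  define H where "H \<omega> = (restrict (\<lambda>s. G s \<omega>) {1..t}, restrict (\<lambda>s. Z s \<omega>) {2..t})" for \<omega>
  define C where "C = PiE {1..t} (\<lambda>_. UNIV :: multigraph set) \<times> PiE {2..t} (\<lambda>_. UNIV :: bool set)"
  let ?c = "pmf (bernoulli_pmf (f (real (t + 1)))) b * pmf (step_pmf b g) h"
  have C: "countable C"
    unfolding C_def by (intro countable_SIGMA countable_PiE countable_multigraphs) auto
  have H: "H \<omega> \<in> C" for \<omega>
    by (simp add: H_def C_def)
  have H_iff: "H \<omega> = x \<longleftrightarrow> (\<forall>s\<in>{1..t}. G s \<omega> = fst x s) \<and> (\<forall>s\<in>{2..t}. Z s \<omega> = snd x s)"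
    if "x \<in> C" for x \<omega>
    using that by (cases x) (auto simp: H_def C_def PiE_def extensional_def fun_eq_iff restrict_def)
  have G_t: "fst x t = g" if "x \<in> C" "H \<omega> = x" "G t \<omega> = g" for x \<omega>
    using that(2,3) assms by (auto simp: H_def)
  have sets_H: "{\<omega> \<in> space M. H \<omega> = x} \<in> sets M" if "x \<in> C" for x
    unfolding H_iff[OF that]
    by (intro sets.sets_Collect_conj sets.sets_Collect_finite_All sets_G_eq sets_Z_eq) auto
  have meas: "{\<omega> \<in> space M. H \<omega> = x \<and> G t \<omega> = g} \<in> sets M"
    "{\<omega> \<in> space M. H \<omega> = x \<and> G t \<omega> = g \<and> Z (t + 1) \<omega> = b \<and> G (t + 1) \<omega> = h} \<in> sets M"
    if "x \<in> C" for x
    using assms by (intro sets.sets_Collect_conj sets_H[OF that] sets_G_eq sets_Z_eq; simp)+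
  have *: "emeasure M {\<omega> \<in> space M. H \<omega> = x \<and> G t \<omega> = g \<and> Z (t + 1) \<omega> = b \<and> G (t + 1) \<omega> = h} =
      emeasure M {\<omega> \<in> space M. H \<omega> = x \<and> G t \<omega> = g} * ennreal ?c" if x: "x \<in> C" for x
  proof (cases "fst x t = g")
    case True
    then have "{\<omega> \<in> space M. H \<omega> = x \<and> G t \<omega> = g} = {\<omega> \<in> space M. H \<omega> = x}"
      and "{\<omega> \<in> space M. H \<omega> = x \<and> G t \<omega> = g \<and> Z (t + 1) \<omega> = b \<and> G (t + 1) \<omega> = h} =
        {\<omega> \<in> space M. H \<omega> = x \<and> Z (t + 1) \<omega> = b \<and> G (t + 1) \<omega> = h}"
      using x assms by (auto simp: H_iff)
    then show ?thesis
      using transition[OF assms, of "fst x" "snd x" b h] True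
      by (simp add: H_iff[OF x] emeasure_eq_measure ennreal_mult' mult.assoc conj_assoc)
  next
    case False
    then have "{\<omega> \<in> space M. H \<omega> = x \<and> G t \<omega> = g} = {}"
      and "{\<omega> \<in> space M. H \<omega> = x \<and> G t \<omega> = g \<and> Z (t + 1) \<omega> = b \<and> G (t + 1) \<omega> = h} = {}"
      using G_t[OF x] by auto
    then show ?thesis by (simp only: emeasure_empty mult_zero_left)
  qed
  have "emeasure M {\<omega> \<in> space M. G t \<omega> = g \<and> Z (t + 1) \<omega> = b \<and> G (t + 1) \<omega> = h} =
      (\<integral>\<^sup>+x. emeasure M {\<omega> \<in> space M. H \<omega> = x \<and> G t \<omega> = g} * ennreal ?c \<partial>count_space C)"
    by (subst emeasure_countable_partition[OF C H meas(2)])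
      (auto intro!: nn_integral_cong simp: *[simplified])
  also have "\<dots> = (\<integral>\<^sup>+x. emeasure M {\<omega> \<in> space M. H \<omega> = x \<and> G t \<omega> = g} \<partial>count_space C) * ennreal ?c"
    by (rule nn_integral_multc) simp
  also have "(\<integral>\<^sup>+x. emeasure M {\<omega> \<in> space M. H \<omega> = x \<and> G t \<omega> = g} \<partial>count_space C) =
      emeasure M {\<omega> \<in> space M. G t \<omega> = g}"
    by (rule emeasure_countable_partition[OF C H meas(1), symmetric])
  finally show ?thesis .
qed

lemma Markov_step:
  assumes "t \<ge> 1"
  shows "emeasure M {\<omega> \<in> space M. G t \<omega> = g \<and> G (Suc t) \<omega> = h} =
    emeasure M {\<omega> \<in> space M. G t \<omega> = g} * ennreal (pmf (step_kernel (f (real (Suc t))) g) h)"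
proof -
  let ?q = "f (real (Suc t))"
  let ?B = "\<lambda>b. {\<omega> \<in> space M. G t \<omega> = g \<and> Z (t + 1) \<omega> = b \<and> G (t + 1) \<omega> = h}"
  have q: "0 \<le> ?q" "?q \<le> 1" by (auto intro!: f_bounds)
  have B: "?B b \<in> sets M" for b
    using assms by (intro sets.sets_Collect_conj sets_G_eq sets_Z_eq) auto
  have "{\<omega> \<in> space M. G t \<omega> = g \<and> G (Suc t) \<omega> = h} = ?B True \<union> ?B False"
    by auto
  then have "emeasure M {\<omega> \<in> space M. G t \<omega> = g \<and> G (Suc t) \<omega> = h} =
      emeasure M (?B True) + emeasure M (?B False)"
    using plus_emeasure[OF B[of True] B[of False]] by (simp add: Int_def disjoint_iff)
  also have "\<dots> = emeasure M {\<omega> \<in> space M. G t \<omega> = g} *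
      (ennreal (pmf (bernoulli_pmf ?q) True * pmf (step_pmf True g) h) +
       ennreal (pmf (bernoulli_pmf ?q) False * pmf (step_pmf False g) h))"
    unfolding Markov_step_Z[OF assms] by (simp add: distrib_left)
  also have "ennreal (pmf (bernoulli_pmf ?q) True * pmf (step_pmf True g) h) +
       ennreal (pmf (bernoulli_pmf ?q) False * pmf (step_pmf False g) h) =
       ennreal (pmf (step_kernel ?q g) h)"
    unfolding step_kernel_def pmf_bind using q
    by (subst ennreal_plus[symmetric]) (auto simp del: ennreal_plus)
  finally show ?thesis .
qed

lemma emeasure_G:
  assumes "t \<ge> 1"
  shows "emeasure M {\<omega> \<in> space M. G t \<omega> = h} = ennreal (pmf (graph_pmf f t) h)"
  using assms
proof (induction t arbitrary: h rule: dec_induct)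
  case base
  show ?case
  proof (cases "h = single_loop")
    case True
    have "prob {\<omega> \<in> space M. G 1 \<omega> = single_loop} = 1"
      using G_start by (intro prob_Collect_eq_1[THEN iffD2] sets_G_eq) auto
    then show ?thesis
      using True by (simp add: emeasure_eq_measure graph_pmf_1)
  next
    case False
    have "prob {\<omega> \<in> space M. G 1 \<omega> = h} = 0"
      using G_start False by (intro prob_Collect_eq_0[THEN iffD2] sets_G_eq) auto
    then show ?thesis
      using False by (simp add: emeasure_eq_measure graph_pmf_1)
  qed
next
  case (step t)
  have "emeasure M {\<omega> \<in> space M. G (Suc t) \<omega> = h} =
      (\<integral>\<^sup>+g. emeasure M {\<omega> \<in> space M. G t \<omega> = g \<and> G (Suc t) \<omega> = h} \<partial>count_space UNIV)"
    using step(1) by (intro emeasure_countable_partition countable_multigraphs)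
      (auto intro: sets.sets_Collect_conj[OF sets_G_eq sets_G_eq])
  also have "\<dots> = (\<integral>\<^sup>+g. ennreal (pmf (step_kernel (f (real (Suc t))) g) h) \<partial>measure_pmf (graph_pmf f t))"
    using step by (simp only: Markov_step nn_integral_measure_pmf)
  also have "\<dots> = ennreal (pmf (graph_pmf f (Suc t)) h)"
    by (simp only: graph_pmf_Suc[OF step(1)] ennreal_pmf_bind)
  finally show ?case .
qed

text \<open>Reduces statements about a single \<open>G t\<close> to computations with a finitely
  supported mass function.\<close>

lemma distr_G:
  assumes "t \<ge> 1"
  shows "distr M (count_space UNIV) (G t) = measure_pmf (graph_pmf f t)"
proof (rule measure_eqI_countable[of _ UNIV])
  fix h
  show "emeasure (distr M (count_space UNIV) (G t)) {h} = emeasure (graph_pmf f t) {h}"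
    using emeasure_G[OF assms, of h]
      sets_G_eq[OF assms]
    by (simp add: emeasure_distr[OF G_measurable[OF assms]] emeasure_pmf_single vimage_def Int_def conj_commute)
qed (simp_all add: countable_multigraphs)

lemma nn_integral_G:
  assumes "t \<ge> 1" "\<And>H. 0 \<le> u H"
  shows "(\<integral>\<^sup>+\<omega>. ennreal (u (G t \<omega>)) \<partial>M) = ennreal (measure_pmf.expectation (graph_pmf f t) u)"
proof -
  have "(\<integral>\<^sup>+\<omega>. ennreal (u (G t \<omega>)) \<partial>M) = (\<integral>\<^sup>+H. ennreal (u H) \<partial>measure_pmf (graph_pmf f t))"
    using assms(1) by (subst distr_G[symmetric]) (auto simp: nn_integral_distr G_measurable)
  then show ?thesis
    using assms by (simp add: nn_integral_eq_integral integrable_measure_pmf_finite finite_set_graph_pmf)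
qed

section \<open>Almost sure properties of the trajectories\<close>

lemma AE_valid_graph: "AE \<omega> in M. \<forall>t\<ge>1. valid_graph t (G t \<omega>)"
proof -
  have "AE \<omega> in M. valid_graph t (G t \<omega>)" if "t \<ge> 1" for t
  proof -
    have "AE H in distr M (count_space UNIV) (G t). valid_graph t H"
      unfolding distr_G[OF that] by (auto simp: AE_measure_pmf_iff intro!: valid_graph_pmf that)
    then show ?thesis
      by (subst (asm) AE_distr_iff) (auto intro!: G_measurable that)
  qed
  then show ?thesis
    by (simp add: AE_all_countable)
qed

text \<open>Each forbidden transition has probability 0, and there are only countably many times and
  pairs of graphs.\<close>

lemma AE_step_kernel: "AE \<omega> in M. \<forall>t\<ge>1. G (Suc t) \<omega> \<in> set_pmf (step_kernel (f (real (Suc t))) (G t \<omega>))"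
proof -
  have "AE \<omega> in M. \<not> (G t \<omega> = g \<and> G (Suc t) \<omega> = h)"
    if "t \<ge> 1" "h \<notin> set_pmf (step_kernel (f (real (Suc t))) g)" for t g h
  proof (rule AE_I)
    show "emeasure M {\<omega> \<in> space M. G t \<omega> = g \<and> G (Suc t) \<omega> = h} = 0"
      using that by (simp add: Markov_step set_pmf_iff)
    show "{\<omega> \<in> space M. G t \<omega> = g \<and> G (Suc t) \<omega> = h} \<in> sets M"
      using that by (intro sets.sets_Collect_conj sets_G_eq) auto
  qed auto
  then have "AE \<omega> in M. \<forall>t. \<forall>g\<in>UNIV. \<forall>h\<in>UNIV. t \<ge> 1 \<and> h \<notin> set_pmf (step_kernel (f (real (Suc t))) g) \<longrightarrow>
      \<not> (G t \<omega> = g \<and> G (Suc t) \<omega> = h)"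
    by (simp only: AE_all_countable AE_ball_countable[OF countable_multigraphs]) auto
  then show ?thesis
    by eventually_elim blast
qed

text \<open>Pathwise form of \<open>deficit_grow\<close>: the deficit minus \<open>d\<close> times
  the number of vertices never increases.\<close>

lemma AE_increments:
  "AE \<omega> in M. \<forall>t\<ge>1. fst (G t \<omega>) \<le> fst (G (Suc t) \<omega>) \<and>
     deficit d (G (Suc t) \<omega>) + d * fst (G t \<omega>) \<le> deficit d (G t \<omega>) + d * fst (G (Suc t) \<omega>)"
  using AE_valid_graph AE_step_kernel
proof eventually_elim
  case (elim \<omega>)
  show ?case
  proof (intro allI impI)
    fix t :: nat assume t: "t \<ge> 1"
    have "valid_graph t (G t \<omega>)" "G (Suc t) \<omega> \<in> set_pmf (step_kernel (f (real (Suc t))) (G t \<omega>))"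
      using elim t by blast+
    from subsetD[OF set_step_kernel[OF this(1) t] this(2)]
    obtain b u1 u2 where u: "u1 \<in> verts (G t \<omega>)" "G (Suc t) \<omega> = grow b u1 u2 (G t \<omega>)"
      by (elim imageE SigmaE) simp
    then show "fst (G t \<omega>) \<le> fst (G (Suc t) \<omega>) \<and>
      deficit d (G (Suc t) \<omega>) + d * fst (G t \<omega>) \<le> deficit d (G t \<omega>) + d * fst (G (Suc t) \<omega>)"
      using deficit_grow[of t "G t \<omega>" u1 d b u2] elim t by (simp add: fst_grow algebra_simps)
  qed
qed

end

section \<open>Moment bounds\<close>

context edge_step_process
begin

definition F :: "nat \<Rightarrow> real" where
  "F t = 1 + (\<Sum>s=2..t. f (real s))"

lemma F_1: "F (Suc 0) = 1"
  by (simp add: F_def)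

lemma F_Suc: "t \<ge> 1 \<Longrightarrow> F (Suc t) = F t + f (real (Suc t))"
  by (simp add: F_def)

lemma F_mono: "s \<le> t \<Longrightarrow> F s \<le> F t"
  unfolding F_def by (intro add_left_mono sum_mono2) (auto intro!: f_bounds)

lemma F_ge_1: "1 \<le> F t"
  unfolding F_def by (auto intro!: sum_nonneg f_bounds)

lemma F_le: "t \<ge> 1 \<Longrightarrow> F t \<le> real t"
proof (induction t rule: dec_induct)
  case (step t)
  then show ?case
    using f_bounds(2)[of "real (Suc t)"] by (simp add: F_Suc)
qed (simp add: F_1)

section \<open>First moment of the deficit\<close>

definition mean_deficit :: "nat \<Rightarrow> nat \<Rightarrow> real" where
  "mean_deficit d t = measure_pmf.expectation (graph_pmf f t) (\<lambda>H. real (deficit d H))"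

lemma mean_deficit_nonneg: "0 \<le> mean_deficit d t"
  by (simp add: mean_deficit_def)

lemma integrable_graph_pmf [simp]:
  fixes u :: "multigraph \<Rightarrow> real"
  shows "t \<ge> 1 \<Longrightarrow> integrable (measure_pmf (graph_pmf f t)) u"
  by (simp add: integrable_measure_pmf_finite finite_set_graph_pmf)

lemma deficit_grow_real:
  assumes "valid_graph t H" "u1 \<in> verts H"
  shows "real (deficit d (grow b u1 u2 H)) \<le>
    real (deficit d H) + real d * of_bool b - of_bool (vertex_degree H u1 \<le> d)"
proof -
  have "real (deficit d (grow b u1 u2 H) + of_bool (vertex_degree H u1 \<le> d)) \<le>
      real (deficit d H + d * of_bool b)"
    using deficit_grow[OF assms, of d b u2] by (simp only: of_nat_le_iff)
  then show ?thesis by simp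
qed

lemma mean_deficit_Suc:
  assumes "t \<ge> 1" "d \<ge> 1"
  shows "mean_deficit d (Suc t) \<le>
    mean_deficit d t + real d * f (real (Suc t)) - mean_deficit d t / (2 * real d * real t)"
proof -
  let ?q = "f (real (Suc t))"
  have "mean_deficit d (Suc t) \<le> measure_pmf.expectation (graph_pmf f t)
      (\<lambda>H. real (deficit d H) + real d * ?q - real (deficit d H) / (2 * real d * real t))"
    unfolding mean_deficit_def
  proof (rule expectation_graph_pmf_Suc_le[OF assms(1)])
    fix H assume H: "valid_graph t H"
    have "measure_pmf.expectation (step_kernel ?q H) (\<lambda>H. real (deficit d H)) \<le>
        real (deficit d H) + real d * ?q +
        (-1) * measure_pmf.expectation (attach_pmf H) (\<lambda>u. of_bool (vertex_degree H u \<le> d))"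
      by (rule step_kernel_expectation_le[OF H assms(1)])
        (use deficit_grow_real[OF H, of _ d] in \<open>auto intro!: f_bounds\<close>)
    then show "measure_pmf.expectation (step_kernel ?q H) (\<lambda>H. real (deficit d H)) \<le>
        real (deficit d H) + real d * ?q - real (deficit d H) / (2 * real d * real t)"
      using attach_low_degree_ge[OF H assms] by linarith
  qed
  then show ?thesis
    using assms(1) by (simp add: mean_deficit_def)
qed

text \<open>Telescopes the drift inequality. The sum of mean deficits over time gives summability in
  the bounded case and the noise bound in the unbounded one.\<close>

lemma sum_mean_deficit_le:
  assumes "t \<ge> 1" "d \<ge> 1"
  shows "mean_deficit d t + (\<Sum>s=1..<t. mean_deficit d s / (2 * real d * real s)) \<le> real d * F t"
  using assms(1)
proof (induction t rule: dec_induct)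
  case base
  have "deficit d single_loop \<le> d"
    by (simp add: deficit_def single_loop_def verts_def vertex_degree_def edges_def)
  then show ?case
    by (simp add: mean_deficit_def graph_pmf_1 F_1)
next
  case (step t)
  then show ?case
    using mean_deficit_Suc[OF step(1) assms(2)] by (simp add: F_Suc distrib_left)
qed

section \<open>Mean and variance of the number of vertices\<close>

lemma mean_vertices_le:
  assumes "t \<ge> 1"
  shows "measure_pmf.expectation (graph_pmf f t) (\<lambda>H. real (fst H)) \<le> F t"
  using assms
proof (induction t rule: dec_induct)
  case base
  then show ?case
    by (simp add: graph_pmf_1 F_1 single_loop_def)
next
  case (step t)
  let ?q = "f (real (Suc t))"
  have "measure_pmf.expectation (graph_pmf f (Suc t)) (\<lambda>H. real (fst H)) \<le>
      measure_pmf.expectation (graph_pmf f t) (\<lambda>H. real (fst H) + ?q)"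
  proof (rule expectation_graph_pmf_Suc_le[OF step(1)])
    fix H assume H: "valid_graph t H"
    \<comment> \<open>The coefficient 0 switches the low-degree indicator off; its threshold 0 is a
      dummy.\<close>
    have "measure_pmf.expectation (step_kernel ?q H) (\<lambda>H. real (fst H)) \<le> real (fst H) + 1 * ?q +
        0 * measure_pmf.expectation (attach_pmf H) (\<lambda>u. of_bool (vertex_degree H u \<le> 0))"
      by (rule step_kernel_expectation_le[OF H step(1)]) (auto intro!: f_bounds simp: fst_grow)
    then show "measure_pmf.expectation (step_kernel ?q H) (\<lambda>H. real (fst H)) \<le> real (fst H) + ?q"
      by simp
  qed
  then show ?case
    using step by (simp add: F_Suc)
qed

text \<open>The centred increment has conditional mean 0 and conditional variance q (1 - q) \<le> q,
  and these bounds add up to at most \<open>F t\<close>.\<close>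

lemma variance_vertices_le:
  assumes "t \<ge> 1"
  shows "measure_pmf.expectation (graph_pmf f t) (\<lambda>H. (real (fst H) - F t)\<^sup>2) \<le> F t"
  using assms
proof (induction t rule: dec_induct)
  case base
  then show ?case
    by (simp add: graph_pmf_1 F_1 single_loop_def)
next
  case (step t)
  let ?q = "f (real (Suc t))"
  have "measure_pmf.expectation (graph_pmf f (Suc t)) (\<lambda>H. (real (fst H) - F (Suc t))\<^sup>2) \<le>
      measure_pmf.expectation (graph_pmf f t) (\<lambda>H. (real (fst H) - F t)\<^sup>2 + ?q)"
  proof (rule expectation_graph_pmf_Suc_le[OF step(1)])
    fix H assume H: "valid_graph t H"
    let ?a = "real (fst H) - F t"
    \<comment> \<open>The coefficient of the indicator is (a + 1 - q)^2 - (a - q)^2.\<close>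
    have "measure_pmf.expectation (step_kernel ?q H) (\<lambda>H. (real (fst H) - F (Suc t))\<^sup>2) \<le>
        (?a - ?q)\<^sup>2 + (2 * ?a + 1 - 2 * ?q) * ?q +
        0 * measure_pmf.expectation (attach_pmf H) (\<lambda>u. of_bool (vertex_degree H u \<le> 0))"
    proof (rule step_kernel_expectation_le[OF H step(1)])
      show "(real (fst (grow b u1 u2 H)) - F (Suc t))\<^sup>2 \<le> (?a - ?q)\<^sup>2 +
          (2 * ?a + 1 - 2 * ?q) * of_bool b + 0 * of_bool (vertex_degree H u1 \<le> 0)" for b u1 u2
        using F_Suc[OF step(1)]
        by (cases b) (simp_all add: fst_grow power2_eq_square algebra_simps)
    qed (auto intro!: f_bounds)
    also have "\<dots> \<le> ?a\<^sup>2 + ?q"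
      by (simp add: power2_eq_square algebra_simps del: of_nat_Suc)
    finally show "measure_pmf.expectation (step_kernel ?q H) (\<lambda>H. (real (fst H) - F (Suc t))\<^sup>2) \<le>
        ?a\<^sup>2 + ?q" .
  qed
  then show ?case
    using step by (simp add: F_Suc)
qed

section \<open>Second moment of the excess\<close>

lemma square_pos_part_step:
  fixes a d x y :: real
  assumes "x \<le> a + d * of_bool b - of_bool c" "0 \<le> d"
  shows "(max 0 x)\<^sup>2 \<le> (max 0 a)\<^sup>2 + (2 * max 0 a * d + d\<^sup>2) * of_bool b + (1 - 2 * max 0 a) * of_bool c"
proof -
  \<comment> \<open>The absolute value covers the case that the sum inside it is negative, where it
    could not be squared as an upper bound.\<close>
  have "max 0 x \<le> \<bar>max 0 a + d * of_bool b - of_bool c\<bar>"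
    using assms by auto
  then have "(max 0 x)\<^sup>2 \<le> (max 0 a + d * of_bool b - of_bool c)\<^sup>2"
    by (metis abs_ge_self abs_le_square_iff abs_of_nonneg max.cobounded1)
  \<comment> \<open>The only term dropped from the expansion is the product of both indicators, with
    coefficient \<open>- 2 * d\<close>.\<close>
  also have "\<dots> \<le> (max 0 a)\<^sup>2 + (2 * max 0 a * d + d\<^sup>2) * of_bool b + (1 - 2 * max 0 a) * of_bool c"
    using assms(2) by (cases b; cases c) (simp_all add: power2_eq_square algebra_simps)
  finally show ?thesis .
qed

definition excess :: "nat \<Rightarrow> real \<Rightarrow> nat \<Rightarrow> multigraph \<Rightarrow> real" where
  "excess d \<eta> t H = max 0 (real (deficit d H) - \<eta> * F t)"

text \<open>Only the positive part of \<open>deficit - \<eta> F\<close> is squared: where it does not vanish, the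
  hypothesis \<open>small\<close> makes the drift of the deficit negative, so that no cross term survives and the
  second moment grows like \<open>F\<close> instead of \<open>F\<^sup>2\<close>.\<close>

lemma excess_step:
  assumes H: "valid_graph t H" and t: "t \<ge> 1" and d: "d \<ge> 1" and "0 < \<eta>"
    and small: "2 * (real d)\<^sup>2 * real t * f (real (Suc t)) \<le> \<eta> * F t"
  shows "measure_pmf.expectation (step_kernel (f (real (Suc t))) H) (\<lambda>H. (excess d \<eta> (Suc t) H)\<^sup>2) \<le>
    (excess d \<eta> t H)\<^sup>2 + (real d)\<^sup>2 * f (real (Suc t)) + real d * real (deficit d H) / (2 * real t)"
proof -
  let ?q = "f (real (Suc t))" and ?a = "real (deficit d H) - \<eta> * F t"
  let ?p = "measure_pmf.expectation (attach_pmf H) (\<lambda>u. of_bool (vertex_degree H u \<le> d))"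
  have "measure_pmf.expectation (step_kernel ?q H) (\<lambda>H. (excess d \<eta> (Suc t) H)\<^sup>2) \<le>
      (max 0 ?a)\<^sup>2 + (2 * max 0 ?a * real d + (real d)\<^sup>2) * ?q + (1 - 2 * max 0 ?a) * ?p"
  proof (rule step_kernel_expectation_le[OF H t])
    fix b u1 u2 assume u: "u1 \<in> verts H"
    have "\<eta> * F t \<le> \<eta> * F (Suc t)"
      using \<open>0 < \<eta>\<close> by (intro mult_left_mono F_mono) auto
    then have "real (deficit d (grow b u1 u2 H)) - \<eta> * F (Suc t) \<le>
        ?a + real d * of_bool b - of_bool (vertex_degree H u1 \<le> d)"
      using deficit_grow_real[OF H u, of d b u2] by linarith
    then show "(excess d \<eta> (Suc t) (grow b u1 u2 H))\<^sup>2 \<le> (max 0 ?a)\<^sup>2 +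
        (2 * max 0 ?a * real d + (real d)\<^sup>2) * of_bool b +
        (1 - 2 * max 0 ?a) * of_bool (vertex_degree H u1 \<le> d)"
      unfolding excess_def by (rule square_pos_part_step) simp
  qed (auto intro!: f_bounds)
  also have "\<dots> = (excess d \<eta> t H)\<^sup>2 + 2 * max 0 ?a * (real d * ?q - ?p) + (real d)\<^sup>2 * ?q + ?p"
    by (simp add: excess_def algebra_simps del: of_nat_Suc)
  also have "2 * max 0 ?a * (real d * ?q - ?p) \<le> 0"
  proof (cases "?a \<le> 0")
    case False
    \<comment> \<open>The constant 2 d^2 in \<open>small\<close> is the growth \<open>d\<close>
      times the factor 2 d in \<open>attach_low_degree_ge\<close>.\<close>
    have "real d * ?q \<le> \<eta> * F t / (2 * real d * real t)"
      using small t d by (simp add: field_simps power2_eq_square del: of_nat_Suc)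
    also have "\<dots> \<le> real (deficit d H) / (2 * real d * real t)"
      using False by (intro divide_right_mono) auto
    also have "\<dots> \<le> ?p"
      by (rule attach_low_degree_ge[OF H t d])
    finally show ?thesis
      by (intro mult_nonneg_nonpos) auto
  qed simp
  also have "?p \<le> real d * real (deficit d H) / (2 * real t)"
    by (rule attach_low_degree_le[OF H t])
  finally show ?thesis by simp
qed

text \<open>Summing \<open>excess_step\<close> over time, the terms with \<open>f\<close> give at
  most d^2 F, and the noise terms are d^2 times those of \<open>sum_mean_deficit_le\<close>, hence
  give at most d^3 F. The initial value at \<open>T\<close> is absorbed by F \<ge> 1.\<close>

lemma second_moment_excess_le:
  assumes T: "T \<ge> 1" and d: "d \<ge> 1" and "0 < \<eta>"
    and small: "\<And>t. t \<ge> T \<Longrightarrow> 2 * (real d)\<^sup>2 * real t * f (real (Suc t)) \<le> \<eta> * F t"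
  obtains C where "0 \<le> C"
    "\<And>t. t \<ge> T \<Longrightarrow> measure_pmf.expectation (graph_pmf f t) (\<lambda>H. (excess d \<eta> t H)\<^sup>2) \<le> C * F t"
proof -
  define q where "q t = measure_pmf.expectation (graph_pmf f t) (\<lambda>H. (excess d \<eta> t H)\<^sup>2)" for t
  define S where "S t = (\<Sum>s=1..<t. mean_deficit d s / (2 * real d * real s))" for t
  let ?D = "(real d)\<^sup>2"
  have q: "q t \<le> q T + ?D * F t + ?D * S t" if "t \<ge> T" for t
    using that
  proof (induction t rule: dec_induct)
    case base
    have "0 \<le> S T"
      unfolding S_def by (intro sum_nonneg divide_nonneg_nonneg mean_deficit_nonneg) auto
    then show ?case
      using F_ge_1[of T] by (auto intro!: mult_nonneg_nonneg)
  next
    case (step t)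
    have t: "t \<ge> 1" using T step by simp
    have "q (Suc t) \<le> measure_pmf.expectation (graph_pmf f t)
       (\<lambda>H. (excess d \<eta> t H)\<^sup>2 + ?D * f (real (Suc t)) + real d * real (deficit d H) / (2 * real t))"
      unfolding q_def using t d small[OF step(1)] \<open>0 < \<eta>\<close>
      by (intro expectation_graph_pmf_Suc_le excess_step)
    also have "\<dots> = q t + ?D * f (real (Suc t)) + real d * mean_deficit d t / (2 * real t)"
      using t by (simp add: q_def mean_deficit_def)
    also have "real d * mean_deficit d t / (2 * real t) = ?D * (mean_deficit d t / (2 * real d * real t))"
      using d by (simp add: power2_eq_square)
    finally show ?case
      using step t by (simp add: F_Suc S_def distrib_left)
  qed
  show thesis
  proof
    show "0 \<le> q T + ?D + ?D * real d"
      by (simp add: q_def)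
    fix t assume t: "t \<ge> T"
    have "S t \<le> real d * F t"
      using sum_mean_deficit_le[of t d] mean_deficit_nonneg[of d t] t T d by (simp add: S_def)
    then have "?D * S t \<le> ?D * (real d * F t)"
      by (intro mult_left_mono) auto
    moreover have "q T \<le> q T * F t"
      using F_ge_1[of t] mult_left_mono[of 1 "F t" "q T"] by (simp add: q_def)
    ultimately show "measure_pmf.expectation (graph_pmf f t) (\<lambda>H. (excess d \<eta> t H)\<^sup>2) \<le>
        (q T + ?D + ?D * real d) * F t"
      using q[OF t] by (simp add: q_def algebra_simps)
  qed
qed

end

section \<open>Regular variation\<close>

text \<open>Says that t f(t) / F(t) tends to 0. Each of the \<open>J\<close> dyadic blocks from t /
  2^(j+1) to t / 2^j has about t / 2^(j+1) integers, where \<open>f\<close> is at least f(t / 2^j),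
  eventually at least 2^j f(t) / 2. So every block adds at least t f(t) / 8 to
  \<open>F\<close>.\<close>

lemma regularly_varying_antimono_bound:
  fixes f :: "real \<Rightarrow> real"
  assumes rv: "regularly_varying f (- \<gamma>)" and "1 \<le> \<gamma>" and pos: "\<And>t. t \<ge> 1 \<Longrightarrow> 0 < f t"
    and anti: "antimono_on {1..} f"
  shows "eventually (\<lambda>t::nat. real J * (real t * f (real t)) \<le> 8 * (1 + (\<Sum>s=2..t. f (real s)))) sequentially"
proof -
  define F where "F t = 1 + (\<Sum>s=2..t. f (real s))" for t :: nat
  have le: "f y \<le> f x" if "1 \<le> x" "x \<le> y" for x y
    using anti that by (auto simp: monotone_on_def)
  have ev: "eventually (\<lambda>t::nat. 2 ^ j / 2 * f (real t) \<le> f (real t / 2 ^ j)) sequentially" for j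
  proof -
    have "((\<lambda>t. f ((1 / 2 ^ j) * t) / f t) \<longlongrightarrow> (1 / 2 ^ j) powr (- \<gamma>)) at_top"
      using rv[unfolded regularly_varying_def, rule_format, of "1 / 2 ^ j"] by simp
    \<comment> \<open>Here \<gamma> \<ge> 1 enters: the limit is at least 2^j, and halving leaves
      room for a strict inequality.\<close>
    moreover have "2 ^ j / 2 < (1 / 2 ^ j) powr (- \<gamma>)"
    proof -
      have "(2 ^ j :: real) powr 1 \<le> (2 ^ j) powr \<gamma>"
        using \<open>1 \<le> \<gamma>\<close> by (intro powr_mono) auto
      then have "(2 :: real) ^ j \<le> (1 / 2 ^ j) powr (- \<gamma>)"
        by (simp add: powr_minus powr_divide inverse_eq_divide)
      moreover have "(2 :: real) ^ j / 2 < 2 ^ j" by simp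
      ultimately show ?thesis by linarith
    qed
    ultimately have "eventually (\<lambda>t. 2 ^ j / 2 < f ((1 / 2 ^ j) * t) / f t) at_top"
      by (rule order_tendstoD(1))
    then have "eventually (\<lambda>t::nat. 2 ^ j / 2 < f ((1 / 2 ^ j) * real t) / f (real t)) sequentially"
      using filterlim_real_sequentially by (rule eventually_compose_filterlim)
    then show ?thesis
      using eventually_ge_at_top[of 1]
    proof eventually_elim
      case (elim t)
      have "0 < f (real t)" using elim by (intro pos) auto
      then show ?case using elim by (simp add: field_simps)
    qed
  qed
  have block: "real t * f (real t) / 8 + F (t div 2 ^ Suc j) \<le> F (t div 2 ^ j)"
    if t: "2 ^ Suc j \<le> t" and f: "2 ^ j / 2 * f (real t) \<le> f (real t / 2 ^ j)" for j t
  proof -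
    define m where "m = t div 2 ^ j"
    have m2: "2 \<le> m"
      using div_le_mono[OF t, of "2 ^ j"] by (simp add: m_def)
    have m_le: "real m \<le> real t / 2 ^ j"
      unfolding m_def by (metis of_nat_div_le_of_nat of_nat_numeral of_nat_power)
    \<comment> \<open>Counting the block: t / 2^j < m + 1 \<le> 2 m since m \<ge> 2, and at least
      half of the integers up to \<open>m\<close> exceed \<open>m div 2\<close>.\<close>
    have "t < 2 ^ j * (m + 1)"
      unfolding m_def using dividend_less_times_div[of "2 ^ j" t] by simp
    then have "real t < real (2 ^ j * (m + 1))"
      by (simp only: of_nat_less_iff)
    then have "real t / 2 ^ j < real m + 1"
      by (simp add: pos_divide_less_eq field_simps)
    then have "real t / 2 ^ j \<le> 2 * real m"
      using m2 by linarith
    moreover have "real m / 2 \<le> real (m - m div 2)"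
      by linarith
    moreover have "x / 4 \<le> z" if "x \<le> 2 * y" "y / 2 \<le> z" for x y z :: real
      using that by linarith
    ultimately have count: "real t / 2 ^ j / 4 \<le> real (m - m div 2)"
      by blast
    have ft: "0 < f (real t)"
      using order_trans[OF one_le_power t] by (intro pos) simp
    have "real t * f (real t) / 8 = (real t / 2 ^ j / 4) * (2 ^ j / 2 * f (real t))"
      by simp
    also have "\<dots> \<le> real (m - m div 2) * f (real t / 2 ^ j)"
      using count f ft by (intro mult_mono) auto
    also have "\<dots> = (\<Sum>s=m div 2 + 1..m. f (real t / 2 ^ j))"
      by simp
    also have "\<dots> \<le> (\<Sum>s=m div 2 + 1..m. f (real s))"
      using m_le by (intro sum_mono le) auto
    also have "\<dots> = F m - F (m div 2)"
    proof -
      have "{2..m} = {2..m div 2} \<union> {m div 2 + 1..m}"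
        using m2 by auto
      then have "(\<Sum>s=2..m. f (real s)) = (\<Sum>s=2..m div 2. f (real s)) + (\<Sum>s=m div 2 + 1..m. f (real s))"
        by (simp add: sum.union_disjoint disjoint_iff)
      then show ?thesis by (simp add: F_def)
    qed
    finally show ?thesis
      by (simp add: m_def power_Suc2 div_mult2_eq del: power_Suc)
  qed
  \<comment> \<open>\<open>J\<close> is fixed, so the finitely many scales can be treated
    simultaneously with pointwise limits.\<close>
  have "eventually (\<lambda>t::nat. \<forall>j\<in>{..<J}. 2 ^ j / 2 * f (real t) \<le> f (real t / 2 ^ j)) sequentially"
    by (intro eventually_ball_finite finite_lessThan ballI ev)
  then show ?thesis
    using eventually_ge_at_top[of "2 ^ J"]
  proof eventually_elim
    case (elim t)
    \<comment> \<open>The blocks are peeled off one at a time; t \<ge> 2^J keeps every one of them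
      nonempty.\<close>
    have "j \<le> J \<Longrightarrow> real j * (real t * f (real t) / 8) + F (t div 2 ^ j) \<le> F t" for j
    proof (induction j)
      case (Suc j)
      have "(2::nat) ^ Suc j \<le> 2 ^ J"
        using Suc.prems by (intro power_increasing) auto
      then have "2 ^ Suc j \<le> t" using elim(2) by linarith
      moreover have "real (Suc j) * (real t * f (real t) / 8) =
          real j * (real t * f (real t) / 8) + real t * f (real t) / 8"
        by (simp add: algebra_simps add_divide_distrib)
      moreover have "real t * f (real t) / 8 + F (t div 2 ^ Suc j) \<le> F (t div 2 ^ j)"
        using Suc.prems elim(1) \<open>2 ^ Suc j \<le> t\<close> by (intro block) auto
      ultimately show ?case
        using Suc.IH Suc.prems by linarith
    qed simp
    from this[of J] have "real J * (real t * f (real t) / 8) + F (t div 2 ^ J) \<le> F t" by simp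
    moreover have "0 \<le> F (t div 2 ^ J)"
      unfolding F_def by (auto intro!: add_nonneg_nonneg sum_nonneg less_imp_le[OF pos])
    ultimately show ?case by (simp add: F_def)
  qed
qed

section \<open>Almost sure convergence\<close>

text \<open>By monotone convergence the sum has finite expectation, hence is almost surely finite.
  It takes the place of Chebyshev with Borel-Cantelli.\<close>

lemma (in prob_space) AE_summable_of_moments:
  fixes X :: "nat \<Rightarrow> 'a \<Rightarrow> real"
  assumes "\<And>k. X k \<in> borel_measurable M" "\<And>k \<omega>. 0 \<le> X k \<omega>"
    and "\<And>k. (\<integral>\<^sup>+\<omega>. ennreal (X k \<omega>) \<partial>M) = ennreal (c k)" "\<And>k. 0 \<le> c k" "summable c"
  shows "AE \<omega> in M. summable (\<lambda>k. X k \<omega>)"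
proof -
  have "(\<integral>\<^sup>+\<omega>. (\<Sum>k. ennreal (X k \<omega>)) \<partial>M) = (\<Sum>k. ennreal (c k))"
    using assms(1,3) by (subst nn_integral_suminf) auto
  also have "\<dots> = ennreal (\<Sum>k. c k)"
    by (rule suminf_ennreal2[OF assms(4,5)])
  finally have "AE \<omega> in M. (\<Sum>k. ennreal (X k \<omega>)) \<noteq> \<infinity>"
    using assms(1) by (intro nn_integral_noteq_infinite) auto
  then show ?thesis
    by eventually_elim (auto intro: summable_suminf_not_top assms(2))
qed

context edge_step_process
begin

lemma AE_summable_G:
  fixes u :: "nat \<Rightarrow> multigraph \<Rightarrow> real"
  assumes "\<And>k. \<tau> k \<ge> 1" "\<And>k H. 0 \<le> u k H"
    and "summable (\<lambda>k. measure_pmf.expectation (graph_pmf f (\<tau> k)) (u k))"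
  shows "AE \<omega> in M. summable (\<lambda>k. u k (G (\<tau> k) \<omega>))"
proof (rule AE_summable_of_moments)
  fix k
  show "(\<lambda>\<omega>. u k (G (\<tau> k) \<omega>)) \<in> borel_measurable M"
    by (rule measurable_compose[OF G_measurable[OF assms(1)]]) simp
  show "(\<integral>\<^sup>+\<omega>. ennreal (u k (G (\<tau> k) \<omega>)) \<partial>M) =
      ennreal (measure_pmf.expectation (graph_pmf f (\<tau> k)) (u k))"
    by (rule nn_integral_G[OF assms(1,2)])
  show "0 \<le> measure_pmf.expectation (graph_pmf f (\<tau> k)) (u k)"
    by (simp add: assms(2))
qed (use assms in auto)

lemma AE_growth: "AE \<omega> in M. \<forall>s\<ge>1. \<forall>t\<ge>s. fst (G s \<omega>) \<le> fst (G t \<omega>) \<and>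
    deficit d (G t \<omega>) + d * fst (G s \<omega>) \<le> deficit d (G s \<omega>) + d * fst (G t \<omega>)"
  using AE_increments[of d]
proof eventually_elim
  case (elim \<omega>)
  show ?case
  proof (intro allI impI)
    fix s t :: nat assume s: "s \<ge> 1" and "t \<ge> s"
    from \<open>t \<ge> s\<close> show "fst (G s \<omega>) \<le> fst (G t \<omega>) \<and>
        deficit d (G t \<omega>) + d * fst (G s \<omega>) \<le> deficit d (G s \<omega>) + d * fst (G t \<omega>)"
    proof (induction t rule: dec_induct)
      case (step t)
      then show ?case
        using elim[rule_format, of t] s by linarith
    qed simp
  qed
qed

section \<open>Bounded expected number of vertices\<close>

lemma AE_vertices_bounded:
  assumes "\<And>t. F t \<le> B"
  shows "AE \<omega> in M. \<exists>N. \<forall>t\<ge>1. fst (G t \<omega>) \<le> N"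
proof -
  let ?V = "\<lambda>t \<omega>. ennreal (real (fst (G (Suc t) \<omega>)))"
  have meas: "?V t \<in> borel_measurable M" for t
    by (rule measurable_compose[OF G_measurable]) simp_all
  \<comment> \<open>The supremum of an increasing sequence with bounded means has finite mean, so it
    is almost surely finite. Only the monotonicity in \<open>AE_growth\<close> is used, hence the
    choice \<open>d = 0\<close>.\<close>
  have "(\<integral>\<^sup>+\<omega>. (SUP t. ?V t \<omega>) \<partial>M) = (SUP t. (\<integral>\<^sup>+\<omega>. ?V t \<omega> \<partial>M))"
  proof (rule nn_integral_monotone_convergence_SUP_AE)
    show "AE \<omega> in M. ?V t \<omega> \<le> ?V (Suc t) \<omega>" for t
      using AE_growth[of 0]
      by eventually_elim (auto intro!: ennreal_leI simp del: ennreal_of_nat_eq_real_of_nat)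
  qed (rule meas)
  also have "\<dots> \<le> ennreal B"
  proof (rule SUP_least)
    fix t
    have "(\<integral>\<^sup>+\<omega>. ?V t \<omega> \<partial>M) =
        ennreal (measure_pmf.expectation (graph_pmf f (Suc t)) (\<lambda>H. real (fst H)))"
      by (rule nn_integral_G) auto
    also have "\<dots> \<le> ennreal B"
      using mean_vertices_le[of "Suc t"] assms[of "Suc t"] by (intro ennreal_leI) simp
    finally show "(\<integral>\<^sup>+\<omega>. ?V t \<omega> \<partial>M) \<le> ennreal B" .
  qed
  finally have "(\<integral>\<^sup>+\<omega>. (SUP t. ?V t \<omega>) \<partial>M) \<noteq> \<infinity>"
    by (auto simp: top_unique)
  then have "AE \<omega> in M. (SUP t. ?V t \<omega>) \<noteq> \<infinity>"
    using meas by (intro nn_integral_noteq_infinite borel_measurable_SUP) auto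
  then show ?thesis
  proof eventually_elim
    case (elim \<omega>)
    then have "(SUP t. ?V t \<omega>) < top"
      by (metis infinity_ennreal_def top.not_eq_extremum)
    then obtain N :: nat where N: "(SUP t. ?V t \<omega>) < of_nat N"
      by (metis ennreal_Ex_less_of_nat)
    have "fst (G t \<omega>) \<le> N" if "t \<ge> 1" for t
    proof -
      have "?V (t - 1) \<omega> \<le> (SUP t. ?V t \<omega>)"
        by (rule SUP_upper) simp
      then have "of_nat (fst (G t \<omega>)) < (of_nat N :: ennreal)"
        using N that by (simp add: ennreal_of_nat_eq_real_of_nat)
      then show ?thesis by simp
    qed
    then show ?case by blast
  qed
qed

lemma AE_degree_proportion_bounded:
  assumes "\<And>t. F t \<le> B" and d: "d \<ge> 1"
  shows "AE \<omega> in M. (\<lambda>t. degree_proportion (G t \<omega>) d) \<longlonglongrightarrow> 0"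
proof -
  have "summable (\<lambda>k. mean_deficit d (Suc k) / real (Suc k))"
  proof (rule summableI_nonneg_bounded)
    fix n
    have "(\<Sum>k<n. mean_deficit d (Suc k) / real (Suc k)) = (\<Sum>s=1..<Suc n. mean_deficit d s / real s)"
      using sum.shift_bounds_Suc_ivl[of "\<lambda>s. mean_deficit d s / real s" 0 n]
      by (simp add: lessThan_atLeast0 del: of_nat_Suc sum.op_ivl_Suc)
    also have "\<dots> = 2 * real d * (\<Sum>s=1..<Suc n. mean_deficit d s / (2 * real d * real s))"
      using d unfolding sum_distrib_left by (intro sum.cong) auto
    also have "\<dots> \<le> 2 * real d * (real d * F (Suc n))"
      using sum_mean_deficit_le[of "Suc n" d] d mean_deficit_nonneg[of d "Suc n"]
      by (intro mult_left_mono) auto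
    also have "\<dots> \<le> 2 * real d * (real d * B)"
      using assms(1) by (intro mult_left_mono) auto
    finally show "(\<Sum>k<n. mean_deficit d (Suc k) / real (Suc k)) \<le> 2 * real d * (real d * B)" .
  qed (simp add: mean_deficit_nonneg)
  then have "AE \<omega> in M. summable (\<lambda>k. real (deficit d (G (Suc k) \<omega>)) / real (Suc k))"
    using AE_summable_G[of Suc "\<lambda>k H. real (deficit d H) / real (Suc k)"]
    by (simp add: mean_deficit_def del: of_nat_Suc)
  then show ?thesis
    using AE_vertices_bounded[OF assms(1)] AE_growth[of d]
  proof eventually_elim
    case (elim \<omega>)
    let ?V = "\<lambda>t. fst (G t \<omega>)"
    from elim(2) obtain N where N: "\<And>t. t \<ge> 1 \<Longrightarrow> ?V t \<le> N" by blast
    \<comment> \<open>A bounded nondecreasing sequence of integers attains its maximum, here at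
      \<open>T\<close>, and stays there; from then on the deficit cannot increase.\<close>
    have "finite (?V ` {1..})" "?V ` {1..} \<noteq> {}"
      using N by (auto intro!: finite_subset[of _ "{..N}"])
    then have "Max (?V ` {1..}) \<in> ?V ` {1..}" by (rule Max_in)
    then obtain T where T: "T \<ge> 1" "?V T = Max (?V ` {1..})" by auto
    have const: "?V t = ?V T" if "t \<ge> T" for t
    proof (rule antisym)
      show "?V t \<le> ?V T"
        using T that \<open>finite _\<close> by auto
      show "?V T \<le> ?V t"
        using elim(3) T that by blast
    qed
    have decr: "deficit d (G t \<omega>) \<le> deficit d (G s \<omega>)" if "T \<le> s" "s \<le> t" for s t
      using elim(3)[rule_format, of s t] const[of s] const[of t] that T by simp
    \<comment> \<open>Otherwise the deficit stays at least 1 from \<open>T\<close> on, and the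
      convergent series of deficit over time dominates a tail of the harmonic series.\<close>
    have "\<exists>s\<ge>T. deficit d (G s \<omega>) = 0"
    proof (rule ccontr)
      assume "\<not> ?thesis"
      then have ge: "1 \<le> deficit d (G s \<omega>)" if "s \<ge> T" for s
        using that by (auto simp: Suc_le_eq)
      have "summable (\<lambda>k. 1 / real (Suc k))"
      proof (rule summable_comparison_test_ev[OF _ elim(1)])
        show "eventually (\<lambda>k. norm (1 / real (Suc k)) \<le> real (deficit d (G (Suc k) \<omega>)) / real (Suc k)) sequentially"
          using eventually_ge_at_top[of T]
        proof eventually_elim
          case (elim k)
          then show ?case
            using ge[of "Suc k"] by (simp add: divide_right_mono del: of_nat_Suc)
        qed
      qed
      then show False
        using not_summable_harmonic[where 'a = real] summable_Suc_iff[of "\<lambda>k. inverse (real k)"]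
        by (simp add: inverse_eq_divide)
    qed
    then obtain s where s: "s \<ge> T" "deficit d (G s \<omega>) = 0" by blast
    have "eventually (\<lambda>t. degree_proportion (G t \<omega>) d = 0) sequentially"
      using eventually_ge_at_top[of s]
    proof eventually_elim
      case (elim t)
      then have "deficit d (G t \<omega>) = 0"
        using decr[of s t] s by simp
      then have "degree_proportion (G t \<omega>) d \<le> 0"
        using degree_proportion_le[of "G t \<omega>" d] by simp
      moreover have "0 \<le> degree_proportion (G t \<omega>) d"
        by (simp add: degree_proportion_def)
      ultimately show ?case by simp
    qed
    then show ?case
      by (rule tendsto_eventually)
  qed
qed

section \<open>Unbounded expected number of vertices: sampling when \<open>F\<close> reaches a
  square\<close>

definition level_time :: "nat \<Rightarrow> nat" where
  "level_time k = (LEAST t. 1 \<le> t \<and> (real k + 1)\<^sup>2 \<le> F t)"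

context
  assumes F_at_top: "filterlim F at_top sequentially"
begin

lemma level_time_exists: "\<exists>t. 1 \<le> t \<and> (real k + 1)\<^sup>2 \<le> F t"
proof -
  have "eventually (\<lambda>t. (real k + 1)\<^sup>2 \<le> F t) sequentially"
    using F_at_top by (auto simp: filterlim_at_top)
  then have "eventually (\<lambda>t. 1 \<le> t \<and> (real k + 1)\<^sup>2 \<le> F t) sequentially"
    using eventually_ge_at_top[of 1] by eventually_elim simp
  then show ?thesis
    unfolding eventually_sequentially by blast
qed

lemma level_time_ge_1: "1 \<le> level_time k"
  and F_level_time_ge: "(real k + 1)\<^sup>2 \<le> F (level_time k)"
  using LeastI_ex[OF level_time_exists[of k]] by (auto simp: level_time_def)

lemma level_time_le: "1 \<le> t \<Longrightarrow> (real k + 1)\<^sup>2 \<le> F t \<Longrightarrow> level_time k \<le> t"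
  unfolding level_time_def by (rule Least_le) simp

text \<open>By minimality \<open>F\<close> is below the square one step earlier, and f \<le> 1
  bounds the overshoot by 1.\<close>

lemma F_level_time_le: "F (level_time k) \<le> (real k + 1)\<^sup>2 + 1"
proof (cases "level_time k = 1")
  case True
  then show ?thesis by (simp add: F_1)
next
  case False
  then obtain s where s: "level_time k = Suc s" "1 \<le> s"
    using level_time_ge_1[of k] by (cases "level_time k") auto
  then have "F s < (real k + 1)\<^sup>2"
    using level_time_le[of s k] by (metis not_less_eq_eq not_le order_refl)
  then show ?thesis
    using s F_Suc[of s] f_bounds(2)[of "real (Suc s)"] by simp
qed

lemma level_time_ge: "k \<le> level_time k"
proof -
  have "real k \<le> (real k + 1)\<^sup>2"
    by (simp add: power2_eq_square algebra_simps)
  then show ?thesis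
    using F_level_time_ge[of k] F_le[OF level_time_ge_1[of k]] by linarith
qed

text \<open>Squares are dense enough for consecutive levels to have ratio tending to 1, which
  permits interpolation between them.\<close>

lemma F_level_time_ratio: "(\<lambda>k. F (level_time (Suc k)) / F (level_time k)) \<longlonglongrightarrow> 1"
proof (rule tendsto_sandwich)
  show "eventually (\<lambda>k. ((real k + 2)\<^sup>2) / ((real k + 1)\<^sup>2 + 1) \<le> F (level_time (Suc k)) / F (level_time k)) sequentially"
    using F_level_time_ge[of "Suc _"] F_level_time_le
    by (intro always_eventually allI frac_le)
      (auto simp: add.commute intro: less_le_trans[OF zero_less_one F_ge_1] order_trans[OF zero_le_one F_ge_1])
  show "eventually (\<lambda>k. F (level_time (Suc k)) / F (level_time k) \<le> ((real k + 2)\<^sup>2 + 1) / ((real k + 1)\<^sup>2)) sequentially"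
    using F_level_time_le[of "Suc _"] F_level_time_ge
    by (intro always_eventually allI frac_le) (auto simp: add.commute)
  show "(\<lambda>k. ((real k + 2)\<^sup>2) / ((real k + 1)\<^sup>2 + 1)) \<longlonglongrightarrow> 1"
    by real_asymp
  show "(\<lambda>k. ((real k + 2)\<^sup>2 + 1) / ((real k + 1)\<^sup>2)) \<longlonglongrightarrow> 1"
    by real_asymp
qed

text \<open>A moment of order F divided by F^2 is at most of order 1 / (k + 1)^2: squares are also
  sparse enough for summability.\<close>

lemma summable_along_level_time:
  assumes nonneg: "\<And>k H. 0 \<le> u k H"
    and bound: "eventually (\<lambda>t. measure_pmf.expectation (graph_pmf f t) (u t) \<le> C * F t) sequentially"
  shows "AE \<omega> in M. (\<lambda>k. u (level_time k) (G (level_time k) \<omega>) / (F (level_time k))\<^sup>2) \<longlonglongrightarrow> 0"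
proof -
  have lim: "filterlim level_time sequentially sequentially"
    by (rule filterlim_at_top_mono[OF filterlim_ident]) (simp add: level_time_ge)
  have bound': "eventually (\<lambda>k. measure_pmf.expectation (graph_pmf f (level_time k)) (u (level_time k)) \<le>
      C * F (level_time k)) sequentially"
    by (rule eventually_compose_filterlim[OF bound lim])
  have "summable (\<lambda>k. measure_pmf.expectation (graph_pmf f (level_time k))
      (\<lambda>H. u (level_time k) H / (F (level_time k))\<^sup>2))"
  proof (rule summable_comparison_test_ev)
    \<comment> \<open>The absolute value is taken because the sign of \<open>C\<close> is
      unspecified.\<close>
    show "summable (\<lambda>k. \<bar>C\<bar> * (1 / (real (Suc k))\<^sup>2))"
      using summable_Suc_iff[of "\<lambda>k. inverse ((real k)\<^sup>2)"] inverse_power_summable[of 2, where 'a = real]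
      by (intro summable_mult) (simp add: inverse_eq_divide)
    show "eventually (\<lambda>k. norm (measure_pmf.expectation (graph_pmf f (level_time k))
        (\<lambda>H. u (level_time k) H / (F (level_time k))\<^sup>2)) \<le> \<bar>C\<bar> * (1 / (real (Suc k))\<^sup>2)) sequentially"
      using bound'
    proof eventually_elim
      case (elim k)
      let ?F = "F (level_time k)"
      have F: "1 \<le> ?F" by (rule F_ge_1)
      have "norm (measure_pmf.expectation (graph_pmf f (level_time k)) (\<lambda>H. u (level_time k) H / ?F\<^sup>2)) =
          measure_pmf.expectation (graph_pmf f (level_time k)) (u (level_time k)) / ?F\<^sup>2"
        by (simp add: nonneg)
      also have "\<dots> \<le> \<bar>C\<bar> * ?F / ?F\<^sup>2"
        using elim F by (intro divide_right_mono) (auto intro: order_trans[OF _ mult_right_mono])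
      also have "\<dots> = \<bar>C\<bar> * (1 / ?F)"
        using F by (simp add: power2_eq_square)
      also have "\<dots> \<le> \<bar>C\<bar> * (1 / (real (Suc k))\<^sup>2)"
        using F_level_time_ge[of k] F by (intro mult_left_mono divide_left_mono mult_pos_pos) (auto simp: add.commute)
      finally show ?case .
    qed
  qed
  then have "AE \<omega> in M. summable (\<lambda>k. u (level_time k) (G (level_time k) \<omega>) / (F (level_time k))\<^sup>2)"
    using AE_summable_G[of level_time "\<lambda>k H. u (level_time k) H / (F (level_time k))\<^sup>2"] level_time_ge_1 nonneg
    by simp
  then show ?thesis
    by eventually_elim (rule summable_LIMSEQ_zero)
qed

lemma AE_vertices_level_time: "AE \<omega> in M. (\<lambda>k. real (fst (G (level_time k) \<omega>)) / F (level_time k)) \<longlonglongrightarrow> 1"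
proof -
  have "eventually (\<lambda>t. measure_pmf.expectation (graph_pmf f t) (\<lambda>H. (real (fst H) - F t)\<^sup>2) \<le> 1 * F t) sequentially"
    using eventually_ge_at_top[of 1] by eventually_elim (simp add: variance_vertices_le)
  then have "AE \<omega> in M. (\<lambda>k. (real (fst (G (level_time k) \<omega>)) - F (level_time k))\<^sup>2 / (F (level_time k))\<^sup>2)
      \<longlonglongrightarrow> 0"
    by (rule summable_along_level_time[rotated]) simp
  then show ?thesis
  proof eventually_elim
    case (elim \<omega>)
    have "(\<lambda>k. (real (fst (G (level_time k) \<omega>)) / F (level_time k) - 1)\<^sup>2) \<longlonglongrightarrow> 0"
      using elim
    proof (rule Lim_transform_eventually)
      have "F t \<noteq> 0" for t
        using F_ge_1[of t] by simp
      then show "eventually (\<lambda>k. (real (fst (G (level_time k) \<omega>)) - F (level_time k))\<^sup>2 / (F (level_time k))\<^sup>2 =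
          (real (fst (G (level_time k) \<omega>)) / F (level_time k) - 1)\<^sup>2) sequentially"
        by (simp add: power_divide[symmetric] diff_divide_distrib)
    qed
    then have "(\<lambda>k. real (fst (G (level_time k) \<omega>)) / F (level_time k) - 1) \<longlonglongrightarrow> 0"
      by (simp add: power_tendsto_0_iff)
    then show ?case
      by (simp add: LIM_zero_iff)
  qed
qed

text \<open>The deficit is at most the excess plus \<eta> F, and the excess is negligible against
  \<open>F\<close>. Taking \<eta> = 1 / (n + 1) leaves countably many null sets.\<close>

lemma AE_deficit_level_time:
  assumes d: "d \<ge> 1"
    and drift: "\<And>A. eventually (\<lambda>t. A * (real t * f (real (Suc t))) \<le> F t) sequentially"
  shows "AE \<omega> in M. (\<lambda>k. real (deficit d (G (level_time k) \<omega>)) / F (level_time k)) \<longlonglongrightarrow> 0"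
proof -
  have *: "AE \<omega> in M. (\<lambda>k. (excess d \<eta> (level_time k) (G (level_time k) \<omega>))\<^sup>2 / (F (level_time k))\<^sup>2) \<longlonglongrightarrow> 0"
    if \<eta>: "0 < \<eta>" for \<eta>
  proof -
    obtain T where T: "T \<ge> 1" "\<And>t. t \<ge> T \<Longrightarrow> 2 * (real d)\<^sup>2 / \<eta> * (real t * f (real (Suc t))) \<le> F t"
    proof -
      obtain T where "\<And>t. t \<ge> T \<Longrightarrow> 2 * (real d)\<^sup>2 / \<eta> * (real t * f (real (Suc t))) \<le> F t"
        using drift[of "2 * (real d)\<^sup>2 / \<eta>"] by (auto simp: eventually_sequentially)
      then show thesis
        by (intro that[of "max 1 T"]) auto
    qed
    have "2 * (real d)\<^sup>2 * real t * f (real (Suc t)) \<le> \<eta> * F t" if "t \<ge> T" for t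
      using T(2)[OF that] \<eta> by (simp add: field_simps del: of_nat_Suc)
    then obtain C where
      "\<And>t. t \<ge> T \<Longrightarrow> measure_pmf.expectation (graph_pmf f t) (\<lambda>H. (excess d \<eta> t H)\<^sup>2) \<le> C * F t"
      using second_moment_excess_le[OF T(1) d \<eta>] by blast
    then have "eventually (\<lambda>t. measure_pmf.expectation (graph_pmf f t) (\<lambda>H. (excess d \<eta> t H)\<^sup>2) \<le> C * F t) sequentially"
      by (auto simp: eventually_sequentially)
    then show ?thesis
      by (rule summable_along_level_time[rotated]) simp
  qed
  have "AE \<omega> in M. \<forall>n. (\<lambda>k. (excess d (1 / real (Suc n)) (level_time k) (G (level_time k) \<omega>))\<^sup>2 /
      (F (level_time k))\<^sup>2) \<longlonglongrightarrow> 0"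
    unfolding AE_all_countable by (intro allI *) simp
  then show ?thesis
  proof eventually_elim
    case (elim \<omega>)
    show ?case
    proof (rule LIMSEQ_I)
      fix r :: real assume "0 < r"
      then obtain n where n: "1 / real (Suc n) < r / 2"
        using reals_Archimedean[of "r / 2"] by (auto simp: inverse_eq_divide)
      let ?e = "\<lambda>k. excess d (1 / real (Suc n)) (level_time k) (G (level_time k) \<omega>)"
      have "(\<lambda>k. (?e k / F (level_time k))\<^sup>2) \<longlonglongrightarrow> 0"
        using elim by (simp add: power_divide del: of_nat_Suc)
      then have "(\<lambda>k. ?e k / F (level_time k)) \<longlonglongrightarrow> 0"
        by (simp add: power_tendsto_0_iff)
      then have "eventually (\<lambda>k. ?e k / F (level_time k) < r / 2) sequentially"
        using \<open>0 < r\<close> by (intro order_tendstoD) auto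
      then obtain K where K: "\<And>k. k \<ge> K \<Longrightarrow> ?e k / F (level_time k) < r / 2"
        by (auto simp: eventually_sequentially)
      have "real (deficit d (G (level_time k) \<omega>)) / F (level_time k) < r" if "k \<ge> K" for k
      proof -
        have F: "0 < F (level_time k)"
          using F_ge_1[of "level_time k"] by simp
        have "real (deficit d (G (level_time k) \<omega>)) \<le> ?e k + 1 / real (Suc n) * F (level_time k)"
          by (simp add: excess_def)
        also have "\<dots> < r / 2 * F (level_time k) + r / 2 * F (level_time k)"
          using K[OF that] F n
          by (intro add_strict_mono mult_strict_right_mono) (auto simp: pos_divide_less_eq)
        finally show ?thesis
          using F by (simp add: pos_divide_less_eq)
      qed
      then show "\<exists>K. \<forall>k\<ge>K. norm (real (deficit d (G (level_time k) \<omega>)) / F (level_time k) - 0) < r"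
        using F_ge_1 by (intro exI[of _ K]) (auto simp: abs_of_nonneg order_trans[OF zero_le_one])
    qed
  qed
qed

text \<open>Between consecutive level times the deficit is at most its value at the first one plus
  \<open>d\<close> times the number of vertices added up to the second, and the number of vertices
  is at least that at the first.\<close>

lemma AE_degree_proportion_unbounded:
  assumes d: "d \<ge> 1"
    and drift: "\<And>A. eventually (\<lambda>t. A * (real t * f (real (Suc t))) \<le> F t) sequentially"
  shows "AE \<omega> in M. (\<lambda>t. degree_proportion (G t \<omega>) d) \<longlonglongrightarrow> 0"
  using AE_vertices_level_time AE_deficit_level_time[OF assms] AE_growth[of d] AE_valid_graph
proof eventually_elim
  case (elim \<omega>)
  let ?V = "\<lambda>t. real (fst (G t \<omega>))" and ?D = "\<lambda>t. real (deficit d (G t \<omega>))"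
  define U where "U k = (?D (level_time k) + real d * (?V (level_time (Suc k)) - ?V (level_time k))) /
    ?V (level_time k)" for k
  \<comment> \<open>The index k with (k + 1)^2 \<le> F t < (k + 2)^2; subtracting 1 is exact because
    F \<ge> 1.\<close>
  define \<kappa> where "\<kappa> t = nat \<lfloor>sqrt (F t)\<rfloor> - 1" for t
  have Fpos: "0 < F t" for t
    using F_ge_1[of t] by simp
  have Vpos: "0 < ?V t" if "t \<ge> 1" for t
    using elim(4) that by (auto simp: valid_graph_def Suc_le_eq)
  \<comment> \<open>Dividing numerator and denominator by \<open>F (level_time k)\<close> leaves
    only known limits; the unsimplified limit mirrors that expression.\<close>
  have "U \<longlonglongrightarrow> (0 + real d * (1 * 1 - 1)) / 1"
  proof (rule Lim_transform_eventually)
    let ?v = "\<lambda>k. ?V (level_time k) / F (level_time k)"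
    show "(\<lambda>k. (?D (level_time k) / F (level_time k) +
        real d * (?v (Suc k) * (F (level_time (Suc k)) / F (level_time k)) - ?v k)) / ?v k)
        \<longlonglongrightarrow> (0 + real d * (1 * 1 - 1)) / 1"
      by (intro tendsto_intros elim(1,2) LIMSEQ_Suc[OF elim(1)] F_level_time_ratio) simp
    show "eventually (\<lambda>k. (?D (level_time k) / F (level_time k) +
        real d * (?v (Suc k) * (F (level_time (Suc k)) / F (level_time k)) - ?v k)) / ?v k = U k) sequentially"
    proof (rule always_eventually, rule allI)
      fix k
      show "(?D (level_time k) / F (level_time k) +
        real d * (?v (Suc k) * (F (level_time (Suc k)) / F (level_time k)) - ?v k)) / ?v k = U k"
        using Fpos[of "level_time k"] Fpos[of "level_time (Suc k)"] Vpos[OF level_time_ge_1[of k]]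
        unfolding U_def by (simp add: divide_simps algebra_simps)
    qed
  qed
  then have U: "U \<longlonglongrightarrow> 0" by simp
  have "filterlim (\<lambda>t. nat \<lfloor>sqrt (F t)\<rfloor>) sequentially sequentially"
    by (intro filterlim_compose[OF filterlim_nat_sequentially] filterlim_compose[OF filterlim_floor_sequentially]
      filterlim_compose[OF sqrt_at_top] F_at_top)
  then have "filterlim \<kappa> sequentially sequentially"
    unfolding \<kappa>_def by (rule filterlim_compose[OF filterlim_minus_const_nat_at_top])
  with U have lim: "(\<lambda>t. U (\<kappa> t)) \<longlonglongrightarrow> 0"
    by (rule filterlim_compose)
  have le: "degree_proportion (G t \<omega>) d \<le> U (\<kappa> t)" if t: "t \<ge> 1" for t
  proof -
    have "1 \<le> sqrt (F t)" using F_ge_1[of t] by simp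
    then have floor: "real (\<kappa> t) + 1 = of_int \<lfloor>sqrt (F t)\<rfloor>"
      unfolding \<kappa>_def by linarith
    have sq: "(sqrt (F t))\<^sup>2 = F t" using Fpos[of t] by simp
    have "(real (\<kappa> t) + 1)\<^sup>2 \<le> (sqrt (F t))\<^sup>2"
      unfolding floor using \<open>1 \<le> sqrt (F t)\<close> by (intro power_mono) auto
    then have lower: "level_time (\<kappa> t) \<le> t"
      using t sq by (intro level_time_le) auto
    have "(sqrt (F t))\<^sup>2 < (real (Suc (\<kappa> t)) + 1)\<^sup>2"
      using floor \<open>1 \<le> sqrt (F t)\<close> by (intro power_strict_mono) (auto, linarith)
    then have "F t < F (level_time (Suc (\<kappa> t)))"
      using F_level_time_ge[of "Suc (\<kappa> t)"] sq by linarith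
    then have upper: "t \<le> level_time (Suc (\<kappa> t))"
      using F_mono[of "level_time (Suc (\<kappa> t))" t] by linarith
    let ?s = "level_time (\<kappa> t)" and ?s' = "level_time (Suc (\<kappa> t))"
    have V: "fst (G ?s \<omega>) \<le> fst (G t \<omega>)" "fst (G t \<omega>) \<le> fst (G ?s' \<omega>)"
      and "deficit d (G t \<omega>) + d * fst (G ?s \<omega>) \<le> deficit d (G ?s \<omega>) + d * fst (G t \<omega>)"
      using elim(3) level_time_ge_1 lower upper t by blast+
    then have "real (deficit d (G t \<omega>) + d * fst (G ?s \<omega>)) \<le> real (deficit d (G ?s \<omega>) + d * fst (G t \<omega>))"
      by (simp only: of_nat_le_iff)
    moreover have "real d * ?V t \<le> real d * ?V ?s'"
      using V by (intro mult_left_mono) auto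
    ultimately have num: "?D t \<le> ?D ?s + real d * (?V ?s' - ?V ?s)"
      by (simp add: algebra_simps)
    have "degree_proportion (G t \<omega>) d \<le> ?D t / ?V t"
      by (rule degree_proportion_le)
    also have "\<dots> \<le> ?D t / ?V ?s"
      using V Vpos[OF level_time_ge_1[of "\<kappa> t"]] by (intro divide_left_mono) auto
    also have "\<dots> \<le> U (\<kappa> t)"
      unfolding U_def using num by (intro divide_right_mono) auto
    finally show ?thesis .
  qed
  show ?case
  proof (rule tendsto_sandwich[OF _ _ tendsto_const lim])
    show "eventually (\<lambda>t. 0 \<le> degree_proportion (G t \<omega>) d) sequentially"
      by (simp add: degree_proportion_def)
    show "eventually (\<lambda>t. degree_proportion (G t \<omega>) d \<le> U (\<kappa> t)) sequentially"
      using eventually_ge_at_top[of 1] by eventually_elim (rule le)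
  qed
qed

end

end

theorem theorem3:
  fixes \<gamma> :: real and f :: "real \<Rightarrow> real" and d :: nat
    and M :: "'a measure" and Z :: "nat \<Rightarrow> 'a \<Rightarrow> bool" and G :: "nat \<Rightarrow> 'a \<Rightarrow> multigraph"
  assumes "\<gamma> \<ge> 1"
    and "f \<in> RES (- \<gamma>)"
    and "edge_step_process M f Z G"
    and "d \<ge> 1"
  shows "AE \<omega> in M. (\<lambda>t. degree_proportion (G t \<omega>) d) \<longlonglongrightarrow> 0"
proof -
  interpret edge_step_process M f Z G by (rule assms(3))
  have pos: "\<And>t. t \<ge> 1 \<Longrightarrow> 0 < f t" and anti: "antimono_on {1..} f"
    and rv: "regularly_varying f (- \<gamma>)"
    using assms(2) by (auto simp: RES_def)
  show ?thesis
  proof (cases "\<exists>B. \<forall>t. F t \<le> B")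
    case True
    then show ?thesis
      using AE_degree_proportion_bounded[OF _ assms(4)] by blast
  next
    case False
    have F_at_top: "filterlim F at_top sequentially"
      unfolding filterlim_at_top
    proof
      fix B
      obtain T where "B \<le> F T"
        using False by (meson linear)
      then have "B \<le> F t" if "t \<ge> T" for t
        using F_mono[OF that] by linarith
      then show "eventually (\<lambda>t. B \<le> F t) sequentially"
        unfolding eventually_sequentially by blast
    qed
    have "eventually (\<lambda>t. A * (real t * f (real (Suc t))) \<le> F t) sequentially" for A
    proof -
      \<comment> \<open>The 8 is the constant of \<open>regularly_varying_antimono_bound\<close>;
        the shift from \<open>t\<close> to \<open>Suc t\<close> costs nothing as \<open>f\<close>
        decreases.\<close>
      obtain J :: nat where J: "8 * A \<le> real J"
        using real_arch_simple by blast
      have "eventually (\<lambda>t. real J * (real t * f (real t)) \<le> 8 * F t) sequentially"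
        unfolding F_def by (rule regularly_varying_antimono_bound[OF rv assms(1) _ anti]) (rule pos)
      then show ?thesis
        using eventually_ge_at_top[of 1]
      proof eventually_elim
        case (elim t)
        have "f (real (Suc t)) \<le> f (real t)" and "0 < f (real (Suc t))"
          using anti elim pos by (auto simp: monotone_on_def)
        then have "8 * (A * (real t * f (real (Suc t)))) \<le> real J * (real t * f (real t))"
          using J by (simp only: mult.assoc[symmetric]) (intro mult_mono; simp)
        then show ?case
          using elim by linarith
      qed
    qed
    then show ?thesis
      by (intro AE_degree_proportion_unbounded F_at_top assms(4))
  qed
qed

end
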